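(* For every countable field $K$ there are valuation domains $R_1$ and $R_2$, both of cardinality $\aleph_1$, both with residue field (isomorphic to) $K$ and with the same value group, such that their quotient fields $Q_1$ and $Q_2$ are generated as $R_1$-, resp. $R_2$-modules by $\aleph_1$ but not by countably many elements, and such that the type $Q_1/R_1$ is essentially uncountable and the type $Q_2/R_2$ is strongly countable.
   Context: A valuation domain is an integral domain whose ideals are linearly ordered by inclusion; its quotient field is denoted $Q$ (with $Q\neq R$). For a valuation domain $R$ of cardinality $\aleph_1$ and an $R$-submodule $J$ of $Q$ with $R\subseteq J$ which is not countably generated, write $J=\bigcup_{\sigma<\omega_1} r_\sigma^{-1}R$ with nonzero $r_\sigma\in R$ such that for $\tau<\sigma$, $r_\tau\mid r_\sigma$ and $r_\sigma\nmid r_\tau$. The type $J/R$ is essentially uncountable if for every $\sigma<\omega_1$ there is $\tau>\sigma$ with $r_\sigma R/r_\tau R$ uncountable; otherwise it is essentially countable. It is strongly countable if $R/r_\sigma R$ is countable for every $\sigma<\omega_1$. These notions are independent of the choice of the $r_\sigma$. *)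

theory Defs
  imports "HOL-Algebra.Algebra"
begin

text \<open>aleph_1 is the cardinal successor of the cardinal of nat; as a well-order,
  cardSuc natLeq is (a copy of) the initial ordinal omega_1, with field omega1_idx.\<close>

abbreviation aleph1 :: "nat set rel" where
  "aleph1 \<equiv> cardSuc natLeq"

abbreviation omega1_idx :: "nat set set" where
  "omega1_idx \<equiv> Field aleph1"

definition card_eq_aleph1 :: "'a set \<Rightarrow> bool" where
  "card_eq_aleph1 A \<longleftrightarrow> (card_of A, aleph1) \<in> ordIso"

definition card_le_aleph1 :: "'a set \<Rightarrow> bool" where
  "card_le_aleph1 A \<longleftrightarrow> (card_of A, aleph1) \<in> ordLeq"

abbreviation subring_ring :: "('a, 'b) ring_scheme \<Rightarrow> 'a set \<Rightarrow> ('a, 'b) ring_scheme" where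
  "subring_ring Q R \<equiv> Q\<lparr>carrier := R\<rparr>"

definition quotient_field_of :: "('a, 'b) ring_scheme \<Rightarrow> 'a set \<Rightarrow> bool" where
  "quotient_field_of Q R \<longleftrightarrow> field Q \<and> subring R Q \<and>
     (\<forall>x\<in>carrier Q. \<exists>a\<in>R. \<exists>b\<in>R. b \<noteq> \<zero>\<^bsub>Q\<^esub> \<and> x = a \<otimes>\<^bsub>Q\<^esub> inv\<^bsub>Q\<^esub> b)"

definition valuation_domain :: "('a, 'b) ring_scheme \<Rightarrow> bool" where
  "valuation_domain R \<longleftrightarrow> domain R \<and>
     (\<forall>I J. ideal I R \<longrightarrow> ideal J R \<longrightarrow> I \<subseteq> J \<or> J \<subseteq> I)"

text \<open>R is a valuation domain with quotient field Q, and Q is different from R (standing assumption).\<close>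
definition valuation_domain_in :: "('a, 'b) ring_scheme \<Rightarrow> 'a set \<Rightarrow> bool" where
  "valuation_domain_in Q R \<longleftrightarrow> quotient_field_of Q R \<and> valuation_domain (subring_ring Q R)
     \<and> R \<noteq> carrier Q"

definition max_ideal :: "('a, 'b) ring_scheme \<Rightarrow> 'a set \<Rightarrow> 'a set" where
  "max_ideal Q R = R - Units (subring_ring Q R)"

definition residue_field :: "('a, 'b) ring_scheme \<Rightarrow> 'a set \<Rightarrow> 'a set ring" where
  "residue_field Q R = (subring_ring Q R) Quot (max_ideal Q R)"

definition value_group :: "('a, 'b) ring_scheme \<Rightarrow> 'a set \<Rightarrow> 'a set monoid" where
  "value_group Q R = (mult_of Q) Mod (Units (subring_ring Q R))"

definition value_le :: "('a, 'b) ring_scheme \<Rightarrow> 'a set \<Rightarrow> 'a set \<Rightarrow> 'a set \<Rightarrow> bool" where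
  "value_le Q R A B \<longleftrightarrow> (\<exists>a\<in>A. \<exists>b\<in>B. b \<otimes>\<^bsub>Q\<^esub> inv\<^bsub>Q\<^esub> a \<in> R)"

definition same_value_group ::
  "('a, 'b) ring_scheme \<Rightarrow> 'a set \<Rightarrow> ('c, 'd) ring_scheme \<Rightarrow> 'c set \<Rightarrow> bool" where
  "same_value_group Q1 R1 Q2 R2 \<longleftrightarrow>
     (\<exists>\<phi>. \<phi> \<in> iso (value_group Q1 R1) (value_group Q2 R2) \<and>
        (\<forall>A\<in>carrier (value_group Q1 R1). \<forall>B\<in>carrier (value_group Q1 R1).
            value_le Q1 R1 A B \<longleftrightarrow> value_le Q2 R2 (\<phi> A) (\<phi> B)))"

definition rspan :: "('a, 'b) ring_scheme \<Rightarrow> 'a set \<Rightarrow> 'a set \<Rightarrow> 'a set" where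
  "rspan Q R S = {finsum Q (\<lambda>s. c s \<otimes>\<^bsub>Q\<^esub> s) F | F c. finite F \<and> F \<subseteq> S \<and> c \<in> F \<rightarrow> R}"

definition principal :: "('a, 'b) ring_scheme \<Rightarrow> 'a set \<Rightarrow> 'a \<Rightarrow> 'a set" where
  "principal Q R r = {r \<otimes>\<^bsub>Q\<^esub> x | x. x \<in> R}"

definition rdvd :: "('a, 'b) ring_scheme \<Rightarrow> 'a set \<Rightarrow> 'a \<Rightarrow> 'a \<Rightarrow> bool" where
  "rdvd Q R a b \<longleftrightarrow> (\<exists>x\<in>R. b = a \<otimes>\<^bsub>Q\<^esub> x)"

definition cosets_in :: "('a, 'b) ring_scheme \<Rightarrow> 'a set \<Rightarrow> 'a set \<Rightarrow> 'a set set" where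
  "cosets_in Q M N = {(\<lambda>y. a \<oplus>\<^bsub>Q\<^esub> y) ` N | a. a \<in> M}"

definition omega1_rep :: "('a, 'b) ring_scheme \<Rightarrow> 'a set \<Rightarrow> 'a set \<Rightarrow> (nat set \<Rightarrow> 'a) \<Rightarrow> bool" where
  "omega1_rep Q R J r \<longleftrightarrow>
     (\<forall>\<sigma>\<in>omega1_idx. r \<sigma> \<in> R \<and> r \<sigma> \<noteq> \<zero>\<^bsub>Q\<^esub>) \<and>
     (\<forall>\<tau>\<in>omega1_idx. \<forall>\<sigma>\<in>omega1_idx. (\<tau>, \<sigma>) \<in> aleph1 \<and> \<tau> \<noteq> \<sigma> \<longrightarrow>
         rdvd Q R (r \<tau>) (r \<sigma>) \<and> \<not> rdvd Q R (r \<sigma>) (r \<tau>)) \<and>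
     J = (\<Union>\<sigma>\<in>omega1_idx. principal Q R (inv\<^bsub>Q\<^esub> (r \<sigma>)))"

definition essentially_uncountable_type :: "('a, 'b) ring_scheme \<Rightarrow> 'a set \<Rightarrow> 'a set \<Rightarrow> bool" where
  "essentially_uncountable_type Q R J \<longleftrightarrow> (\<exists>r. omega1_rep Q R J r) \<and>
     (\<forall>r. omega1_rep Q R J r \<longrightarrow>
        (\<forall>\<sigma>\<in>omega1_idx. \<exists>\<tau>\<in>omega1_idx. (\<sigma>, \<tau>) \<in> aleph1 \<and> \<sigma> \<noteq> \<tau> \<and>
           \<not> countable (cosets_in Q (principal Q R (r \<sigma>)) (principal Q R (r \<tau>)))))"

definition strongly_countable_type :: "('a, 'b) ring_scheme \<Rightarrow> 'a set \<Rightarrow> 'a set \<Rightarrow> bool" where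
  "strongly_countable_type Q R J \<longleftrightarrow> (\<exists>r. omega1_rep Q R J r) \<and>
     (\<forall>r. omega1_rep Q R J r \<longrightarrow>
        (\<forall>\<sigma>\<in>omega1_idx. countable (cosets_in Q R (principal Q R (r \<sigma>)))))"

end

theory Submission
  imports Defs "HOL-Library.Countable_Set_Type"
begin

text \<open>
  Let \<open>G\<close> be the group of finitely supported functions from \<open>\<omega>\<^sub>1\<close> to the integers, ordered by the
  coefficient at the largest index where two functions differ. The unit vectors form a cofinal chain
  of type \<open>\<omega>\<^sub>1\<close>, so every countable subset of \<open>G\<close> is bounded, while every interval \<open>{0..<g}\<close> is
  countable. Both quotient fields are subfields of cardinality \<open>\<aleph>\<^sub>1\<close> of the field \<open>K((G))\<close> of Hahn
  series that contain all monomials; the valuation is the least exponent, and taking the coefficient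
  at \<open>0\<close> identifies the residue field with \<open>K\<close>.

  \<open>Q\<^sub>2\<close> consists of the quotients of finitely supported series. Modulo an element of value \<open>g\<close>,
  such a quotient in the valuation ring depends only on the terms with exponents in \<open>{0..<g}\<close> of a
  numerator and a denominator of value \<open>0\<close>, which leaves countably many residues. \<open>Q\<^sub>1\<close> contains in
  addition \<open>\<aleph>\<^sub>1\<close> series with supports in a fixed increasing sequence of exponents; they stay distinct
  modulo every element whose value exceeds that sequence.
\<close>

section \<open>Cardinal arithmetic\<close>

lemma Times_Cinfinite_bound:
  assumes "|A| \<le>o r" "|B| \<le>o r" "Cinfinite r"
  shows "|A \<times> B| \<le>o r"
  using assms by (intro card_of_Times_ordLeq_infinite_Field) (auto simp: cinfinite_def)

lemma Fpow_Cinfinite_bound: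
  assumes "|A| \<le>o r" "Cinfinite r"
  shows "|Fpow A| \<le>o r"
proof -
  have field_iso: "|Field r| =o r"
    using assms(2) by (intro card_of_Field_ordIso) simp
  then have "|A| \<le>o |Field r|"
    using assms(1) by (meson ordIso_symmetric ordLeq_ordIso_trans)
  then obtain f where f: "inj_on f A" "f ` A \<subseteq> Field r"
    unfolding card_of_ordLeq[symmetric] by blast
  have "inj_on (image f) (Fpow A)" "image f ` Fpow A \<subseteq> Fpow (Field r)"
    using f by (auto intro!: inj_on_image_Fpow image_Fpow_mono)
  then have "|Fpow A| \<le>o |Fpow (Field r)|"
    by (intro card_of_ordLeqI[where f = "image f"]) auto
  also have "|Fpow (Field r)| =o |Field r|"
    using assms(2) by (intro card_of_Fpow_infinite) (auto simp: cinfinite_def)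
  also note field_iso
  finally show ?thesis .
qed

lemma restricted_funspace_ordLeq_Fpow:
  "|{f. f ` A \<subseteq> B \<and> {x. f x \<noteq> k x} \<subseteq> A \<and> finite {x. f x \<noteq> k x}}| \<le>o |Fpow (A \<times> B)|"
  using lepoll_restricted_funspace unfolding lepoll_def card_of_ordLeq .

lemma countable_Cinfinite_bound:
  assumes "countable A" "Cinfinite r"
  shows "|A| \<le>o r"
  using assms(1) natLeq_ordLeq_cinfinite[OF assms(2)] unfolding countable_card_le_natLeq
  by (rule ordLeq_transitive)

lemma exists_closed_superset_Cinfinite_bound:
  fixes F :: "('a \<Rightarrow> 'a \<Rightarrow> 'a) set"
  assumes F: "|F| \<le>o r" and H: "|H| \<le>o r" and r: "Cinfinite r"
  obtains C where "H \<subseteq> C" "|C| \<le>o r" "\<And>f x y. f \<in> F \<Longrightarrow> x \<in> C \<Longrightarrow> y \<in> C \<Longrightarrow> f x y \<in> C"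
proof -
  define extend where "extend Y = Y \<union> (\<lambda>(f, x, y). f x y) ` (F \<times> Y \<times> Y)" for Y
  define stage where "stage n = (extend ^^ n) H" for n
  have stage_Suc: "stage (Suc n) = extend (stage n)" for n by (simp add: stage_def)
  have mono: "mono stage" unfolding mono_iff_le_Suc by (simp add: stage_Suc extend_def)
  have bounded: "|stage n| \<le>o r" for n
  proof (induction n)
    case 0
    show ?case using H by (simp add: stage_def)
  next
    case (Suc n)
    then have "|F \<times> stage n \<times> stage n| \<le>o r" by (intro Times_Cinfinite_bound F r)
    then have "|(\<lambda>(f, x, y). f x y) ` (F \<times> stage n \<times> stage n)| \<le>o r"
      by (rule ordLeq_transitive[OF card_of_image])
    then show ?case unfolding stage_Suc extend_def using Suc r by (intro Un_Cinfinite_bound)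
  qed
  show thesis
  proof (rule that)
    have "stage 0 = H" by (simp add: stage_def)
    then show "H \<subseteq> (\<Union>n. stage n)" by blast
    show "|\<Union>n. stage n| \<le>o r"
      using countable_Cinfinite_bound[OF _ r, of "UNIV :: nat set"] bounded r
      by (intro UNION_Cinfinite_bound) auto
    fix f x y assume f: "f \<in> F" and "x \<in> (\<Union>n. stage n)" "y \<in> (\<Union>n. stage n)"
    then obtain m n where "x \<in> stage m" "y \<in> stage n" by blast
    then have "x \<in> stage (max m n)" "y \<in> stage (max m n)"
      using monoD[OF mono, of m "max m n"] monoD[OF mono, of n "max m n"] by auto
    then have "f x y \<in> stage (Suc (max m n))" using f by (force simp: stage_Suc extend_def)
    then show "f x y \<in> (\<Union>n. stage n)" by blast
  qed
qed

lemma (in field) generate_field_Cinfinite_bound: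
  assumes "|H| \<le>o r" "Cinfinite r"
  shows "|generate_field R H| \<le>o r"
proof -
  let ?ops = "{(\<oplus>), (\<otimes>), \<lambda>x y. \<ominus> x, \<lambda>x y. inv x}"
  have "|?ops| \<le>o r" "|{\<one>} \<union> H| \<le>o r"
    by (intro Un_Cinfinite_bound countable_Cinfinite_bound assms; simp)+
  then obtain C where C: "{\<one>} \<union> H \<subseteq> C" "|C| \<le>o r"
    and closed: "\<And>f x y. f \<in> ?ops \<Longrightarrow> x \<in> C \<Longrightarrow> y \<in> C \<Longrightarrow> f x y \<in> C"
    using assms(2) by (rule exists_closed_superset_Cinfinite_bound) blast
  have "generate_field R H \<subseteq> C"
  proof
    fix x assume "x \<in> generate_field R H"
    then show "x \<in> C"
    proof induction
      case (a_inv h)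
      then show ?case using closed[of "\<lambda>x y. \<ominus> x" h h] by simp
    next
      case (m_inv h)
      then show ?case using closed[of "\<lambda>x y. inv x" h h] by simp
    qed (use C(1) closed[of "(\<oplus>)"] closed[of "(\<otimes>)"] in auto)
  qed
  then show ?thesis using C(2) by (meson card_of_mono1 ordLeq_transitive)
qed

lemma Cinfinite_aleph1: "Cinfinite aleph1"
  by (rule Cinfinite_cardSuc[OF natLeq_Cinfinite])

lemma card_of_omega1_idx: "|omega1_idx| =o aleph1"
  using Cinfinite_aleph1 by (intro card_of_Field_ordIso) simp

lemma countable_iff_ordLess_aleph1: "countable A \<longleftrightarrow> |A| <o aleph1"
  unfolding countable_card_le_natLeq
  by (simp add: cardSuc_ordLeq_ordLess natLeq_Card_order card_of_Card_order)

lemma uncountable_omega1_idx: "uncountable omega1_idx"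
  by (meson card_of_omega1_idx countable_iff_ordLess_aleph1 not_ordLess_ordIso)

lemma countable_underS_aleph1:
  assumes "a \<in> omega1_idx"
  shows "countable (underS aleph1 a)"
  unfolding countable_iff_ordLess_aleph1
  using Cinfinite_aleph1 assms by (intro card_of_underS) simp_all

lemma Linear_order_aleph1: "Linear_order aleph1"
  using Cinfinite_aleph1 by (simp add: card_order_on_def well_order_on_def)

lemma aleph1_total:
  assumes "a \<in> omega1_idx" "b \<in> omega1_idx" "a \<noteq> b"
  shows "(a, b) \<in> aleph1 \<or> (b, a) \<in> aleph1"
  using assms Linear_order_aleph1 by (simp add: order_on_defs total_on_def)

lemma countable_bounded_aleph1:
  assumes "countable B" "B \<subseteq> omega1_idx"
  shows "\<exists>a\<in>omega1_idx. \<forall>b\<in>B. (b, a) \<in> aleph1 \<and> b \<noteq> a"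
proof -
  have "\<not> |B| =o aleph1"
    using assms(1) by (auto simp: countable_iff_ordLess_aleph1 dest: not_ordLess_ordIso)
  then have "\<not> cofinal B aleph1"
    using assms(2) regularCard_cardSuc[OF natLeq_Cinfinite] by (auto simp: regularCard_def)
  then obtain c where c: "c \<in> omega1_idx" "\<And>b. b \<in> B \<Longrightarrow> b = c \<or> (b, c) \<in> aleph1"
    using assms(2) aleph1_total by (auto simp: cofinal_def) blast
  obtain a where a: "a \<in> omega1_idx" "c \<noteq> a" "(c, a) \<in> aleph1"
    using infinite_Card_order_limit[of aleph1 c] Cinfinite_aleph1 c(1)
    by (auto simp: cinfinite_def)
  have "trans aleph1" "antisym aleph1"
    using Linear_order_aleph1 by (simp_all add: order_on_defs)
  then have "\<forall>b\<in>B. (b, a) \<in> aleph1 \<and> b \<noteq> a"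
    using a c(2) by (metis antisymD transD)
  then show ?thesis using a(1) by blast
qed

lemma card_le_aleph1_subset: "card_le_aleph1 B \<Longrightarrow> A \<subseteq> B \<Longrightarrow> card_le_aleph1 A"
  unfolding card_le_aleph1_def by (rule ordLeq_transitive[OF card_of_mono1])

section \<open>The value group\<close>

locale omega1_scale =
  fixes scale :: "nat set \<Rightarrow> 'g::linordered_ab_group_add"
  assumes scale_pos: "0 < scale \<sigma>"
    and scale_less: "\<lbrakk>(\<tau>, \<sigma>) \<in> aleph1; \<tau> \<noteq> \<sigma>\<rbrakk> \<Longrightarrow> scale \<tau> < scale \<sigma>"
    and scale_cofinal: "\<exists>\<sigma>\<in>omega1_idx. g < scale \<sigma>"
begin

lemma countable_bounded:
  assumes "countable (S :: 'g set)"
  shows "\<exists>\<sigma>\<in>omega1_idx. \<forall>g\<in>S. g < scale \<sigma>"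
proof -
  obtain \<tau> where \<tau>: "\<And>g. \<tau> g \<in> omega1_idx" "\<And>g. g < scale (\<tau> g)"
    using scale_cofinal by metis
  then obtain \<sigma> where \<sigma>: "\<sigma> \<in> omega1_idx" "\<forall>g\<in>S. (\<tau> g, \<sigma>) \<in> aleph1 \<and> \<tau> g \<noteq> \<sigma>"
    using countable_bounded_aleph1[of "\<tau> ` S"] assms by auto
  then have "g < scale \<sigma>" if "g \<in> S" for g
    using \<tau>(2)[of g] scale_less[of "\<tau> g" \<sigma>] that by (meson order_less_trans)
  then show ?thesis using \<sigma>(1) by blast
qed

lemma inj_on_scale: "inj_on scale omega1_idx"
proof (rule inj_onI, rule ccontr)
  fix \<sigma> \<tau> assume "\<sigma> \<in> omega1_idx" "\<tau> \<in> omega1_idx" "scale \<sigma> = scale \<tau>" "\<sigma> \<noteq> \<tau>"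
  then show False
    using aleph1_total[of \<sigma> \<tau>] scale_less[of \<sigma> \<tau>] scale_less[of \<tau> \<sigma>] by auto
qed

end

typedef omega1_dual = omega1_idx
  using uncountable_omega1_idx by (metis countable_empty ex_in_conv)

text \<open>The order of \<open>\<omega>\<^sub>1\<close> is reversed because the lexicographic order on finitely supported functions
  compares at the smallest index first, whereas here the largest ordinal has to dominate.\<close>

instantiation omega1_dual :: linorder
begin

definition less_eq_omega1_dual :: "omega1_dual \<Rightarrow> omega1_dual \<Rightarrow> bool" where
  "a \<le> b \<longleftrightarrow> (Rep_omega1_dual b, Rep_omega1_dual a) \<in> aleph1"

definition less_omega1_dual :: "omega1_dual \<Rightarrow> omega1_dual \<Rightarrow> bool" where
  "a < b \<longleftrightarrow> a \<le> b \<and> \<not> b \<le> (a::omega1_dual)"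

instance
proof
  have order: "Refl aleph1" "trans aleph1" "antisym aleph1"
    using Linear_order_aleph1 by (simp_all add: order_on_defs)
  fix x y z :: omega1_dual
  show "x < y \<longleftrightarrow> x \<le> y \<and> \<not> y \<le> x"
    by (simp add: less_omega1_dual_def)
  show refl: "x \<le> x" for x :: omega1_dual
    using order(1) Rep_omega1_dual by (auto simp: less_eq_omega1_dual_def refl_on_def)
  show "x \<le> z" if "x \<le> y" "y \<le> z"
    using that order(2) unfolding less_eq_omega1_dual_def by (meson transD)
  show "x = y" if "x \<le> y" "y \<le> x"
    using that order(3) unfolding less_eq_omega1_dual_def by (metis Rep_omega1_dual_inject antisymD)
  show "x \<le> y \<or> y \<le> x"
    using aleph1_total[OF Rep_omega1_dual[of x] Rep_omega1_dual[of y]] refl[of x]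
    unfolding less_eq_omega1_dual_def by (metis Rep_omega1_dual_inject)
qed

end

lemma Abs_omega1_dual_less:
  assumes "(\<tau>, \<sigma>) \<in> aleph1" "\<tau> \<noteq> \<sigma>"
  shows "Abs_omega1_dual \<sigma> < Abs_omega1_dual \<tau>"
proof -
  have "\<tau> \<in> omega1_idx" "\<sigma> \<in> omega1_idx"
    using assms(1) by (auto intro: FieldI1 FieldI2)
  then show ?thesis
    using assms
    by (simp add: order_less_le less_eq_omega1_dual_def Abs_omega1_dual_inverse Abs_omega1_dual_inject)
qed

lemma countable_atLeast_omega1_dual: "countable {a :: omega1_dual ..}"
proof -
  have "Rep_omega1_dual ` {a<..} \<subseteq> underS aleph1 (Rep_omega1_dual a)"
    by (auto simp: underS_def order_less_le less_eq_omega1_dual_def Rep_omega1_dual_inject)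
  then have "countable (Rep_omega1_dual ` {a<..})"
    by (rule countable_subset) (rule countable_underS_aleph1[OF Rep_omega1_dual])
  then have "countable {a<..}"
    by (rule countable_image_inj_on) (simp add: inj_on_def Rep_omega1_dual_inject)
  moreover have "{a..} = insert a {a<..}" by auto
  ultimately show ?thesis by simp
qed

type_synonym lex_group = "omega1_dual \<Rightarrow>\<^sub>0 int"

lemma poly_mapping_ordLeq_Fpow:
  "|{f :: 'a \<Rightarrow>\<^sub>0 'b::zero. Poly_Mapping.keys f \<subseteq> A}| \<le>o |Fpow (A \<times> (UNIV :: 'b set))|"
proof -
  let ?F = "{f :: 'a \<Rightarrow>\<^sub>0 'b. Poly_Mapping.keys f \<subseteq> A}"
  let ?G = "{f :: 'a \<Rightarrow> 'b. f ` A \<subseteq> UNIV \<and> {x. f x \<noteq> 0} \<subseteq> A \<and> finite {x. f x \<noteq> 0}}"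
  have "inj_on Poly_Mapping.lookup ?F" "Poly_Mapping.lookup ` ?F \<subseteq> ?G"
    by (auto simp: inj_on_def poly_mapping_eqI in_keys_iff)
  then have "|?F| \<le>o |?G|"
    by (intro card_of_ordLeqI[where f = Poly_Mapping.lookup]) auto
  then show ?thesis
    using restricted_funspace_ordLeq_Fpow by (rule ordLeq_transitive)
qed

lemma less_poly_mapping_iff:
  fixes g h :: "'a::linorder \<Rightarrow>\<^sub>0 'b::{zero, linorder}"
  shows "g < h \<longleftrightarrow> (\<exists>k. Poly_Mapping.lookup g k < Poly_Mapping.lookup h k \<and>
    (\<forall>k'<k. Poly_Mapping.lookup g k' = Poly_Mapping.lookup h k'))"
  by (simp add: less_poly_mapping.rep_eq less_fun_def)

lemma less_poly_mapping_single:
  fixes g :: "'a::linorder \<Rightarrow>\<^sub>0 'b::{zero, linorder}"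
  assumes "0 < c" "\<And>k. k \<in> Poly_Mapping.keys g \<Longrightarrow> a < k"
  shows "g < Poly_Mapping.single a c"
  unfolding less_poly_mapping_iff
proof (intro exI conjI allI impI)
  have vanishes: "Poly_Mapping.lookup g k = 0" if "k \<le> a" for k
    using assms(2)[of k] that by (meson in_keys_iff leD)
  then show "Poly_Mapping.lookup g a < Poly_Mapping.lookup (Poly_Mapping.single a c) a"
    using assms(1) by simp
  show "Poly_Mapping.lookup g k = Poly_Mapping.lookup (Poly_Mapping.single a c) k" if "k < a" for k
    using that vanishes[of k] by (simp add: lookup_single_not_eq)
qed

lemma lookup_less_Min_keys:
  fixes g :: "'a::linorder \<Rightarrow>\<^sub>0 'b::zero"
  shows "k < Min (Poly_Mapping.keys g) \<Longrightarrow> Poly_Mapping.lookup g k = 0"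
  by (metis Min_le finite_keys in_keys_iff leD)

lemma keys_subset_atLeast_Min_keys:
  fixes g h :: "'a::linorder \<Rightarrow>\<^sub>0 'b::{zero, linorder}"
  assumes h: "\<not> h < 0" "\<not> g < h"
  shows "Poly_Mapping.keys h \<subseteq> {Min (Poly_Mapping.keys g)..}"
proof (rule ccontr)
  let ?k = "Min (Poly_Mapping.keys g)" and ?m = "Min (Poly_Mapping.keys h)"
  assume "\<not> Poly_Mapping.keys h \<subseteq> {?k..}"
  then obtain i where i: "i \<in> Poly_Mapping.keys h" "i < ?k" by (metis atLeast_iff not_le subsetI)
  then have "?m \<in> Poly_Mapping.keys h" "?m \<le> i" by (auto intro: Min_in)
  then have m: "?m < ?k" "Poly_Mapping.lookup h ?m \<noteq> 0"
    using i(2) by (auto simp: in_keys_iff)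
  have "\<not> Poly_Mapping.lookup h ?m < 0"
    using h(1) lookup_less_Min_keys[of _ h] unfolding less_poly_mapping_iff by (metis lookup_zero)
  then have "Poly_Mapping.lookup g ?m < Poly_Mapping.lookup h ?m"
    using m lookup_less_Min_keys[OF m(1)] by simp
  moreover have "\<forall>j<?m. Poly_Mapping.lookup g j = Poly_Mapping.lookup h j"
    using m(1) by (simp add: lookup_less_Min_keys)
  ultimately show False using h(2) unfolding less_poly_mapping_iff by blast
qed

lemma card_le_aleph1_lex_group: "card_le_aleph1 (UNIV :: lex_group set)"
proof -
  have "range Rep_omega1_dual \<subseteq> omega1_idx" "inj Rep_omega1_dual"
    using Rep_omega1_dual by (auto simp: inj_on_def Rep_omega1_dual_inject)
  then have "|UNIV :: omega1_dual set| \<le>o aleph1"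
    by (meson card_of_ordLeq card_of_omega1_idx ordLeq_ordIso_trans)
  moreover have "|UNIV :: int set| \<le>o aleph1"
    by (intro countable_Cinfinite_bound Cinfinite_aleph1) simp
  ultimately have "|Fpow ((UNIV :: omega1_dual set) \<times> (UNIV :: int set))| \<le>o aleph1"
    by (intro Fpow_Cinfinite_bound Times_Cinfinite_bound Cinfinite_aleph1)
  then show ?thesis
    using ordLeq_transitive[OF poly_mapping_ordLeq_Fpow[of UNIV]] by (simp add: card_le_aleph1_def)
qed

lemma countable_lex_group_interval: "countable {0..<g :: lex_group}"
proof (rule countable_subset)
  let ?keys = "{Min (Poly_Mapping.keys g)..}"
  show "{0..<g} \<subseteq> {h. Poly_Mapping.keys h \<subseteq> ?keys}"
  proof
    fix h assume h: "h \<in> {0..<g}"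
    have "\<not> h < 0" using h by (simp add: not_less)
    moreover have "\<not> g < h" using h by (auto dest: order.strict_trans)
    ultimately show "h \<in> {h. Poly_Mapping.keys h \<subseteq> ?keys}"
      by (simp add: keys_subset_atLeast_Min_keys)
  qed
  show "countable {h :: lex_group. Poly_Mapping.keys h \<subseteq> ?keys}"
    by (rule countable_ordLeq[OF poly_mapping_ordLeq_Fpow])
      (simp add: countable_Fpow countable_atLeast_omega1_dual)
qed

definition lex_scale :: "nat set \<Rightarrow> lex_group" where
  "lex_scale \<sigma> = Poly_Mapping.single (Abs_omega1_dual \<sigma>) 1"

lemma omega1_scale_lex_scale: "omega1_scale lex_scale"
proof
  fix \<sigma> \<tau> and g :: lex_group
  show "0 < lex_scale \<sigma>"
    unfolding lex_scale_def by (rule less_poly_mapping_single) simp_all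
  show "lex_scale \<tau> < lex_scale \<sigma>" if "(\<tau>, \<sigma>) \<in> aleph1" "\<tau> \<noteq> \<sigma>"
    unfolding lex_scale_def
    by (rule less_poly_mapping_single) (use Abs_omega1_dual_less[OF that] in simp_all)
  have "countable (Rep_omega1_dual ` Poly_Mapping.keys g)" by (simp add: countable_finite)
  then obtain \<sigma> where \<sigma>: "\<sigma> \<in> omega1_idx"
      "\<And>k. k \<in> Poly_Mapping.keys g \<Longrightarrow> (Rep_omega1_dual k, \<sigma>) \<in> aleph1 \<and> Rep_omega1_dual k \<noteq> \<sigma>"
    using countable_bounded_aleph1[of "Rep_omega1_dual ` Poly_Mapping.keys g"] Rep_omega1_dual
    by auto
  have "g < lex_scale \<sigma>"
    unfolding lex_scale_def
  proof (rule less_poly_mapping_single)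
    show "Abs_omega1_dual \<sigma> < k" if "k \<in> Poly_Mapping.keys g" for k
      using Abs_omega1_dual_less \<sigma>(2)[OF that] by (metis Rep_omega1_dual_inverse)
  qed simp
  then show "\<exists>\<sigma>\<in>omega1_idx. g < lex_scale \<sigma>" using \<sigma>(1) by blast
qed

section \<open>Well-ordered subsets of linearly ordered groups\<close>

lemma wfp_on_less_least:
  assumes "wfp_on S ((<) :: 'a::linorder \<Rightarrow> _)" "B \<subseteq> S" "B \<noteq> {}"
  obtains m where "m \<in> B" "\<And>x. x \<in> B \<Longrightarrow> m \<le> x"
  using assms unfolding wfp_on_iff_ex_minimal by (metis not_less)

lemma wfp_on_less_if_initial_segments:
  assumes "\<And>g. g \<in> S \<Longrightarrow> wfp_on (S \<inter> {..g}) ((<) :: 'a::linorder \<Rightarrow> _)"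
  shows "wfp_on S (<)"
  unfolding wfp_on_iff_ex_minimal
proof (intro allI impI)
  fix B assume B: "B \<subseteq> S" "B \<noteq> {}"
  then obtain g where "g \<in> B" by blast
  then obtain m where m: "m \<in> B \<inter> {..g}" "\<And>x. x \<in> B \<inter> {..g} \<Longrightarrow> m \<le> x"
    using wfp_on_less_least[OF assms, of g "B \<inter> {..g}"] B(1) by blast
  then have "x \<notin> B" if "x < m" for x
    using that by (meson IntD2 IntI atMost_iff leD less_imp_le order_trans)
  then show "\<exists>m\<in>B. \<forall>x. x < m \<longrightarrow> x \<notin> B" using m(1) by blast
qed

lemma wfp_on_less_finite: "finite S \<Longrightarrow> wfp_on S ((<) :: 'a::linorder \<Rightarrow> _)"
  by (intro strict_partial_order_wfp_on_finite_set) auto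

lemma wfp_on_less_mono_subseq:
  fixes s :: "nat \<Rightarrow> 'a::linorder"
  assumes "wfp_on S (<)" "\<And>n. s n \<in> S"
  obtains r :: "nat \<Rightarrow> nat" where "strict_mono r" "mono (\<lambda>n. s (r n))"
proof -
  obtain f :: "nat \<Rightarrow> nat" where f: "strict_mono f" "monoseq (\<lambda>n. s (f n))"
    using seq_monosub by blast
  then consider (increasing) "mono (\<lambda>n. s (f n))" | (decreasing) "\<And>m n. m \<le> n \<Longrightarrow> s (f n) \<le> s (f m)"
    by (auto simp: monoseq_def mono_def)
  then show thesis
  proof cases
    case increasing
    then show thesis using f(1) that by blast
  next
    case decreasing
    have "range (\<lambda>n. s (f n)) \<subseteq> S" "range (\<lambda>n. s (f n)) \<noteq> {}"
      using assms(2) by auto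
    then obtain m where "m \<in> range (\<lambda>n. s (f n))" "\<And>x. x \<in> range (\<lambda>n. s (f n)) \<Longrightarrow> m \<le> x"
      by (rule wfp_on_less_least[OF assms(1)]) blast
    then obtain N where least: "\<And>n. s (f N) \<le> s (f n)" by blast
    have "s (f (N + n)) = s (f N)" for n
      by (intro antisym least decreasing) simp
    then have "mono (\<lambda>n. s (f (N + n)))" by (simp add: mono_def)
    moreover have "strict_mono (\<lambda>n. f (N + n))"
      using f(1) by (simp add: strict_mono_def)
    ultimately show thesis using that by blast
  qed
qed

lemma wfp_on_lessI:
  assumes "\<And>s :: nat \<Rightarrow> 'a::linorder. (\<And>n. s n \<in> S) \<Longrightarrow> \<exists>i j. i < j \<and> s i \<le> s j"
  shows "wfp_on S (<)"
proof (rule ccontr)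
  assume "\<not> wfp_on S (<)"
  then obtain B where B: "B \<subseteq> S" "B \<noteq> {}" "\<forall>x\<in>B. \<exists>y\<in>B. y < x"
    unfolding wfp_on_iff_ex_minimal by metis
  have "\<exists>s. \<forall>n. s n \<in> B \<and> s (Suc n) < s n"
    using B(2,3) by (intro dependent_nat_choice) blast+
  then obtain s where s: "\<And>n. s n \<in> B" "\<And>n. s (Suc n) < s n" by blast
  obtain i j where ij: "i < j" "s i \<le> s j"
    using assms[of s] s(1) B(1) by blast
  have "s j \<le> s (Suc i)"
    using less_imp_le[OF s(2)] by (rule lift_Suc_antimono_le) (use ij(1) in simp)
  then show False using ij(2) s(2)[of i] by simp
qed

lemma wfp_on_less_Un:
  assumes "wfp_on S ((<) :: 'a::linorder \<Rightarrow> _)" "wfp_on T (<)"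
  shows "wfp_on (S \<union> T) (<)"
proof (rule wfp_on_lessI)
  fix s :: "nat \<Rightarrow> 'a" assume s: "\<And>n. s n \<in> S \<union> T"
  have good_pair: "\<exists>i j. i < j \<and> s i \<le> s j"
    if wfp: "wfp_on U (<)" and inf: "infinite {n. s n \<in> U}" for U
  proof -
    obtain f :: "nat \<Rightarrow> nat" where f: "strict_mono f" "\<And>n. s (f n) \<in> U"
      using infinite_enumerate[OF inf] by blast
    obtain r :: "nat \<Rightarrow> nat" where "strict_mono r" "mono (\<lambda>n. s (f (r n)))"
      using wfp_on_less_mono_subseq[of U "\<lambda>n. s (f n)", OF wfp f(2)] .
    then have "f (r 0) < f (r 1)" "s (f (r 0)) \<le> s (f (r 1))"
      using f(1) by (simp_all add: strict_mono_def mono_def)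
    then show ?thesis by blast
  qed
  have "{n. s n \<in> S} \<union> {n. s n \<in> T} = UNIV" using s by auto
  then have "infinite {n. s n \<in> S} \<or> infinite {n. s n \<in> T}"
    by (metis finite_Un infinite_UNIV_nat)
  then show "\<exists>i j. i < j \<and> s i \<le> s j" using assms good_pair by blast
qed

lemma wfp_on_less_sums:
  fixes S T :: "'g::linordered_ab_group_add set"
  assumes "wfp_on S (<)" "wfp_on T (<)"
  shows "wfp_on ((\<lambda>(a, b). a + b) ` (S \<times> T)) (<)"
proof (rule wfp_on_lessI)
  fix s :: "nat \<Rightarrow> 'g" assume "\<And>n. s n \<in> (\<lambda>(a, b). a + b) ` (S \<times> T)"
  then have "\<forall>n. \<exists>a b. s n = a + b \<and> a \<in> S \<and> b \<in> T" by fastforce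
  then obtain a b where ab: "\<And>n. s n = a n + b n" "\<And>n. a n \<in> S" "\<And>n. b n \<in> T"
    unfolding choice_iff by blast
  obtain p :: "nat \<Rightarrow> nat" where p: "strict_mono p" "mono (\<lambda>n. a (p n))"
    using wfp_on_less_mono_subseq[of S a, OF assms(1) ab(2)] .
  obtain q :: "nat \<Rightarrow> nat" where q: "strict_mono q" "mono (\<lambda>n. b (p (q n)))"
    using wfp_on_less_mono_subseq[of T "\<lambda>n. b (p n)", OF assms(2) ab(3)] .
  have "q 0 < q 1" using q(1) by (simp add: strict_mono_def)
  then have "p (q 0) < p (q 1)" "s (p (q 0)) \<le> s (p (q 1))"
    using p monoD[OF q(2), of 0 1] unfolding ab(1)
    by (auto simp: strict_mono_def mono_def intro!: add_mono)
  then show "\<exists>i j. i < j \<and> s i \<le> s j" by blast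
qed

lemma finite_wfp_on_less_fibre:
  fixes S T :: "'g::linordered_ab_group_add set"
  assumes "wfp_on S (<)" "wfp_on T (<)"
  shows "finite {a \<in> S. g - a \<in> T}"
proof (rule ccontr)
  assume "infinite {a \<in> S. g - a \<in> T}"
  then obtain s :: "nat \<Rightarrow> 'g" where s: "inj s" "\<And>n. s n \<in> S" "\<And>n. g - s n \<in> T"
    using infinite_countable_subset[of "{a \<in> S. g - a \<in> T}"] by (auto simp: image_subset_iff)
  obtain p :: "nat \<Rightarrow> nat" where p: "strict_mono p" "mono (\<lambda>n. s (p n))"
    using wfp_on_less_mono_subseq[of S s, OF assms(1) s(2)] .
  obtain q :: "nat \<Rightarrow> nat" where q: "strict_mono q" "mono (\<lambda>n. g - s (p (q n)))"
    using wfp_on_less_mono_subseq[of T "\<lambda>n. g - s (p n)", OF assms(2) s(3)] .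
  have "q 0 < q 1" using q(1) by (simp add: strict_mono_def)
  then have "p (q 0) \<noteq> p (q 1)" "s (p (q 0)) = s (p (q 1))"
    using p monoD[OF q(2), of 0 1] by (auto simp: strict_mono_eq mono_def intro!: antisym)
  then show False using s(1) by (simp add: inj_eq)
qed

section \<open>The field of Hahn series\<close>

definition hahn_ring :: "('k, 'e) ring_scheme \<Rightarrow> ('g::linordered_ab_group_add \<Rightarrow> 'k) ring" where
  "hahn_ring K =
     \<lparr> carrier = {f. range f \<subseteq> carrier K \<and> wfp_on {g. f g \<noteq> \<zero>\<^bsub>K\<^esub>} (<)},
       monoid.mult = (\<lambda>f h g. \<Oplus>\<^bsub>K\<^esub>a\<in>{a. f a \<noteq> \<zero>\<^bsub>K\<^esub> \<and> h (g - a) \<noteq> \<zero>\<^bsub>K\<^esub>}. f a \<otimes>\<^bsub>K\<^esub> h (g - a)),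
       monoid.one = (\<lambda>g. if g = 0 then \<one>\<^bsub>K\<^esub> else \<zero>\<^bsub>K\<^esub>),
       ring.zero = (\<lambda>g. \<zero>\<^bsub>K\<^esub>),
       ring.add = (\<lambda>f h g. f g \<oplus>\<^bsub>K\<^esub> h g) \<rparr>"

lemma (in abelian_monoid) finsum_swap:
  assumes "finite A" "finite B" "\<And>a b. a \<in> A \<Longrightarrow> b \<in> B \<Longrightarrow> F a b \<in> carrier G"
  shows "(\<Oplus>a\<in>A. \<Oplus>b\<in>B. F a b) = (\<Oplus>b\<in>B. \<Oplus>a\<in>A. F a b)"
  using assms(1,3)
proof (induction A rule: finite_induct)
  case empty
  then show ?case by (simp add: finsum_zero)
next
  case (insert x A)
  have "(\<Oplus>a\<in>insert x A. \<Oplus>b\<in>B. F a b) = (\<Oplus>b\<in>B. F x b) \<oplus> (\<Oplus>a\<in>A. \<Oplus>b\<in>B. F a b)"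
    using insert by (intro finsum_insert) (auto intro!: finsum_closed)
  also have "\<dots> = (\<Oplus>b\<in>B. F x b) \<oplus> (\<Oplus>b\<in>B. \<Oplus>a\<in>A. F a b)"
    using insert by simp
  also have "\<dots> = (\<Oplus>b\<in>B. F x b \<oplus> (\<Oplus>a\<in>A. F a b))"
    using insert by (intro finsum_addf[symmetric]) (auto intro!: finsum_closed)
  also have "\<dots> = (\<Oplus>b\<in>B. \<Oplus>a\<in>insert x A. F a b)"
    using insert by (intro finsum_cong') (auto intro!: finsum_closed finsum_insert[symmetric])
  finally show ?case .
qed

context field
begin

abbreviation supp :: "('g \<Rightarrow> 'a) \<Rightarrow> 'g set" where
  "supp f \<equiv> {g. f g \<noteq> \<zero>}"

abbreviation hahn :: "('g::linordered_ab_group_add \<Rightarrow> 'a) ring" where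
  "hahn \<equiv> hahn_ring R"

lemma
  shows hahn_carrier_iff: "f \<in> carrier hahn \<longleftrightarrow> range f \<subseteq> carrier R \<and> wfp_on (supp f) (<)"
    and hahn_one: "\<one>\<^bsub>hahn\<^esub> = (\<lambda>g. if g = 0 then \<one> else \<zero>)"
    and hahn_zero: "\<zero>\<^bsub>hahn\<^esub> = (\<lambda>g. \<zero>)"
    and hahn_add: "f \<oplus>\<^bsub>hahn\<^esub> h = (\<lambda>g. f g \<oplus> h g)"
  by (simp_all add: hahn_ring_def)

lemmas hahn_simps = hahn_carrier_iff hahn_one hahn_zero hahn_add

lemma hahn_coeff_closed: "f \<in> carrier hahn \<Longrightarrow> f g \<in> carrier R"
  by (auto simp: hahn_simps)

lemma finite_hahn_fibre:
  assumes "f \<in> carrier hahn" "h \<in> carrier hahn"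
  shows "finite {a. f a \<noteq> \<zero> \<and> h (g - a) \<noteq> \<zero>}"
  using finite_wfp_on_less_fibre[of "supp f" "supp h" g] assms by (simp add: hahn_simps)

lemma hahn_mult_coeff:
  assumes "f \<in> carrier hahn" "h \<in> carrier hahn" "finite A"
    and "\<And>a. f a \<noteq> \<zero> \<Longrightarrow> h (g - a) \<noteq> \<zero> \<Longrightarrow> a \<in> A"
  shows "(f \<otimes>\<^bsub>hahn\<^esub> h) g = (\<Oplus>a\<in>A. f a \<otimes> h (g - a))"
proof -
  have "(f \<otimes>\<^bsub>hahn\<^esub> h) g = (\<Oplus>a\<in>{a. f a \<noteq> \<zero> \<and> h (g - a) \<noteq> \<zero>}. f a \<otimes> h (g - a))"
    by (simp add: hahn_ring_def)
  also have "\<dots> = (\<Oplus>a\<in>A. f a \<otimes> h (g - a))"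
    by (rule add.finprod_mono_neutral_cong_left)
      (use assms hahn_coeff_closed[OF assms(1)] hahn_coeff_closed[OF assms(2)] in auto)
  finally show ?thesis .
qed

lemma hahn_mult_nonzero:
  assumes "(f \<otimes>\<^bsub>hahn\<^esub> h) g \<noteq> \<zero>"
  obtains a where "f a \<noteq> \<zero>" "h (g - a) \<noteq> \<zero>"
proof -
  have "{a. f a \<noteq> \<zero> \<and> h (g - a) \<noteq> \<zero>} \<noteq> {}"
    using assms by (intro notI) (simp add: hahn_ring_def)
  then show thesis using that by blast
qed

lemma supp_hahn_mult: "supp (f \<otimes>\<^bsub>hahn\<^esub> h) \<subseteq> (\<lambda>(a, b). a + b) ` (supp f \<times> supp h)"
proof clarify
  fix g assume "(f \<otimes>\<^bsub>hahn\<^esub> h) g \<noteq> \<zero>"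
  then obtain a where "f a \<noteq> \<zero>" "h (g - a) \<noteq> \<zero>" by (rule hahn_mult_nonzero)
  then show "g \<in> (\<lambda>(a, b). a + b) ` (supp f \<times> supp h)"
    by (intro image_eqI[of _ _ "(a, g - a)"]) auto
qed

lemma hahn_mult_closed:
  assumes "f \<in> carrier hahn" "h \<in> carrier hahn"
  shows "f \<otimes>\<^bsub>hahn\<^esub> h \<in> carrier hahn"
proof -
  have "(f \<otimes>\<^bsub>hahn\<^esub> h) g \<in> carrier R" for g
    unfolding hahn_ring_def
    using hahn_coeff_closed[OF assms(1)] hahn_coeff_closed[OF assms(2)]
    by (auto intro: finsum_closed)
  moreover have "wfp_on (supp (f \<otimes>\<^bsub>hahn\<^esub> h)) (<)"
    using assms by (intro wfp_on_subset[OF wfp_on_less_sums supp_hahn_mult]) (auto simp: hahn_simps)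
  ultimately show ?thesis by (auto simp: hahn_simps)
qed

lemma hahn_mult_comm:
  assumes "f \<in> carrier hahn" "h \<in> carrier hahn"
  shows "f \<otimes>\<^bsub>hahn\<^esub> h = h \<otimes>\<^bsub>hahn\<^esub> f"
proof
  fix g
  note [simp] = hahn_coeff_closed[OF assms(1)] hahn_coeff_closed[OF assms(2)]
  let ?A = "{a. f a \<noteq> \<zero> \<and> h (g - a) \<noteq> \<zero>}"
  have "(f \<otimes>\<^bsub>hahn\<^esub> h) g = (\<Oplus>a\<in>?A. h (g - a) \<otimes> f (g - (g - a)))"
    unfolding hahn_ring_def by (auto simp: m_comm intro!: finsum_cong')
  also have "\<dots> = (\<Oplus>b\<in>(\<lambda>a. g - a) ` ?A. h b \<otimes> f (g - b))"
    by (rule finsum_reindex[symmetric]) (auto simp: inj_on_def)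
  also have "\<dots> = (h \<otimes>\<^bsub>hahn\<^esub> f) g"
  proof (rule hahn_mult_coeff[symmetric])
    show "b \<in> (\<lambda>a. g - a) ` ?A" if "h b \<noteq> \<zero>" "f (g - b) \<noteq> \<zero>" for b
      using that by (intro image_eqI[of _ _ "g - b"]) auto
  qed (use assms finite_hahn_fibre in auto)
  finally show "(f \<otimes>\<^bsub>hahn\<^esub> h) g = (h \<otimes>\<^bsub>hahn\<^esub> f) g" .
qed

lemma hahn_triple_product_coeff:
  assumes f: "f \<in> carrier hahn" and h: "h \<in> carrier hahn" and k: "k \<in> carrier hahn"
    and fin: "finite A" "finite B"
    and cover: "\<And>a b. f a \<noteq> \<zero> \<Longrightarrow> h b \<noteq> \<zero> \<Longrightarrow> k (g - a - b) \<noteq> \<zero> \<Longrightarrow> a \<in> A \<and> b \<in> B"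
  shows "(f \<otimes>\<^bsub>hahn\<^esub> (h \<otimes>\<^bsub>hahn\<^esub> k)) g = (\<Oplus>a\<in>A. \<Oplus>b\<in>B. f a \<otimes> (h b \<otimes> k (g - a - b)))"
proof -
  note [simp] = hahn_coeff_closed[OF f] hahn_coeff_closed[OF h] hahn_coeff_closed[OF k]
    hahn_coeff_closed[OF hahn_mult_closed[OF h k]]
  have "(f \<otimes>\<^bsub>hahn\<^esub> (h \<otimes>\<^bsub>hahn\<^esub> k)) g = (\<Oplus>a\<in>A. f a \<otimes> (h \<otimes>\<^bsub>hahn\<^esub> k) (g - a))"
    by (rule hahn_mult_coeff[OF f hahn_mult_closed[OF h k] fin(1)])
      (use cover in \<open>auto elim: hahn_mult_nonzero\<close>)
  also have "\<dots> = (\<Oplus>a\<in>A. \<Oplus>b\<in>B. f a \<otimes> (h b \<otimes> k (g - a - b)))"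
  proof (rule finsum_cong')
    fix a
    show "f a \<otimes> (h \<otimes>\<^bsub>hahn\<^esub> k) (g - a) = (\<Oplus>b\<in>B. f a \<otimes> (h b \<otimes> k (g - a - b)))"
    proof (cases "f a = \<zero>")
      case False
      then have "(h \<otimes>\<^bsub>hahn\<^esub> k) (g - a) = (\<Oplus>b\<in>B. h b \<otimes> k (g - a - b))"
        using cover by (intro hahn_mult_coeff h k fin(2)) blast
      then show ?thesis by (simp add: finsum_rdistr fin(2))
    qed (simp add: finsum_zero)
  qed (auto intro!: finsum_closed)
  finally show ?thesis .
qed

lemma hahn_mult_left_comm:
  assumes f: "f \<in> carrier hahn" and h: "h \<in> carrier hahn" and k: "k \<in> carrier hahn"
  shows "f \<otimes>\<^bsub>hahn\<^esub> (h \<otimes>\<^bsub>hahn\<^esub> k) = h \<otimes>\<^bsub>hahn\<^esub> (f \<otimes>\<^bsub>hahn\<^esub> k)"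
proof
  fix g
  note [simp] = hahn_coeff_closed[OF f] hahn_coeff_closed[OF h] hahn_coeff_closed[OF k]
  define fibre where
    "fibre x y = {a \<in> supp x. g - a \<in> (\<lambda>(b, c). b + c) ` (supp y \<times> supp k)}" for x y
  have "wfp_on (supp f) (<)" "wfp_on (supp h) (<)" "wfp_on (supp k) (<)"
    using f h k by (auto simp: hahn_simps)
  then have fibre_finite: "finite (fibre f h)" "finite (fibre h f)"
    unfolding fibre_def by (simp_all only: finite_wfp_on_less_fibre[OF _ wfp_on_less_sums])
  have fibreI: "a \<in> fibre x y" if "x a \<noteq> \<zero>" "y b \<noteq> \<zero>" "k (g - a - b) \<noteq> \<zero>" for x y a b
    unfolding fibre_def using that by (auto intro!: image_eqI[of _ _ "(b, g - a - b)"])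
  have swap: "g - a - b = g - b - a" for a b :: 'c by (simp add: algebra_simps)
  have "(f \<otimes>\<^bsub>hahn\<^esub> (h \<otimes>\<^bsub>hahn\<^esub> k)) g = (\<Oplus>a\<in>fibre f h. \<Oplus>b\<in>fibre h f. f a \<otimes> (h b \<otimes> k (g - a - b)))"
    by (rule hahn_triple_product_coeff[OF f h k fibre_finite]) (metis fibreI swap)
  also have "\<dots> = (\<Oplus>b\<in>fibre h f. \<Oplus>a\<in>fibre f h. f a \<otimes> (h b \<otimes> k (g - a - b)))"
    by (rule finsum_swap[OF fibre_finite]) simp
  also have "\<dots> = (\<Oplus>b\<in>fibre h f. \<Oplus>a\<in>fibre f h. h b \<otimes> (f a \<otimes> k (g - b - a)))"
    by (intro finsum_cong') (auto simp: swap m_lcomm intro!: finsum_closed)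
  also have "\<dots> = (h \<otimes>\<^bsub>hahn\<^esub> (f \<otimes>\<^bsub>hahn\<^esub> k)) g"
    by (rule hahn_triple_product_coeff[OF h f k fibre_finite(2,1), symmetric]) (metis fibreI swap)
  finally show "(f \<otimes>\<^bsub>hahn\<^esub> (h \<otimes>\<^bsub>hahn\<^esub> k)) g = (h \<otimes>\<^bsub>hahn\<^esub> (f \<otimes>\<^bsub>hahn\<^esub> k)) g" .
qed

lemma hahn_mult_assoc:
  assumes "f \<in> carrier hahn" "h \<in> carrier hahn" "k \<in> carrier hahn"
  shows "(f \<otimes>\<^bsub>hahn\<^esub> h) \<otimes>\<^bsub>hahn\<^esub> k = f \<otimes>\<^bsub>hahn\<^esub> (h \<otimes>\<^bsub>hahn\<^esub> k)"
  using assms by (metis hahn_mult_closed hahn_mult_comm hahn_mult_left_comm)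

lemma hahn_mult_add_distrib:
  assumes f: "f \<in> carrier hahn" and h: "h \<in> carrier hahn" and k: "k \<in> carrier hahn"
    and fh: "f \<oplus>\<^bsub>hahn\<^esub> h \<in> carrier hahn"
  shows "(f \<oplus>\<^bsub>hahn\<^esub> h) \<otimes>\<^bsub>hahn\<^esub> k = f \<otimes>\<^bsub>hahn\<^esub> k \<oplus>\<^bsub>hahn\<^esub> h \<otimes>\<^bsub>hahn\<^esub> k"
proof
  fix g
  note [simp] = hahn_coeff_closed[OF f] hahn_coeff_closed[OF h] hahn_coeff_closed[OF k]
  define A where "A = {a. f a \<noteq> \<zero> \<and> k (g - a) \<noteq> \<zero>} \<union> {a. h a \<noteq> \<zero> \<and> k (g - a) \<noteq> \<zero>}"
  have A: "finite A" unfolding A_def using finite_hahn_fibre f h k by blast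
  have "((f \<oplus>\<^bsub>hahn\<^esub> h) \<otimes>\<^bsub>hahn\<^esub> k) g = (\<Oplus>a\<in>A. (f \<oplus>\<^bsub>hahn\<^esub> h) a \<otimes> k (g - a))"
    by (rule hahn_mult_coeff[OF fh k A]) (auto simp: A_def hahn_add)
  also have "\<dots> = (\<Oplus>a\<in>A. f a \<otimes> k (g - a)) \<oplus> (\<Oplus>a\<in>A. h a \<otimes> k (g - a))"
    by (simp add: hahn_add l_distr finsum_addf)
  also have "(\<Oplus>a\<in>A. f a \<otimes> k (g - a)) = (f \<otimes>\<^bsub>hahn\<^esub> k) g"
    by (rule hahn_mult_coeff[OF f k A, symmetric]) (auto simp: A_def)
  also have "(\<Oplus>a\<in>A. h a \<otimes> k (g - a)) = (h \<otimes>\<^bsub>hahn\<^esub> k) g"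
    by (rule hahn_mult_coeff[OF h k A, symmetric]) (auto simp: A_def)
  finally show "((f \<oplus>\<^bsub>hahn\<^esub> h) \<otimes>\<^bsub>hahn\<^esub> k) g = (f \<otimes>\<^bsub>hahn\<^esub> k \<oplus>\<^bsub>hahn\<^esub> h \<otimes>\<^bsub>hahn\<^esub> k) g"
    by (simp add: hahn_add)
qed

lemma hahn_abelian_group: "abelian_group (hahn :: ('g::linordered_ab_group_add \<Rightarrow> 'a) ring)"
proof (rule abelian_groupI)
  fix f h :: "'g \<Rightarrow> 'a"
  assume f: "f \<in> carrier hahn" and h: "h \<in> carrier hahn"
  have "supp (f \<oplus>\<^bsub>hahn\<^esub> h) \<subseteq> supp f \<union> supp h"
    by (auto simp: hahn_simps)
  then have "wfp_on (supp (f \<oplus>\<^bsub>hahn\<^esub> h)) (<)"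
    by (rule wfp_on_subset[rotated]) (use f h in \<open>auto simp: hahn_simps intro: wfp_on_less_Un\<close>)
  then show "f \<oplus>\<^bsub>hahn\<^esub> h \<in> carrier hahn"
    using hahn_coeff_closed[OF f] hahn_coeff_closed[OF h] by (auto simp: hahn_simps)
  show "f \<oplus>\<^bsub>hahn\<^esub> h = h \<oplus>\<^bsub>hahn\<^esub> f"
    using hahn_coeff_closed[OF f] hahn_coeff_closed[OF h] by (auto simp: hahn_simps a_comm)
next
  show "\<zero>\<^bsub>hahn\<^esub> \<in> carrier hahn"
    by (auto simp: hahn_simps wfp_on_less_finite)
next
  fix f h k :: "'g \<Rightarrow> 'a"
  assume "f \<in> carrier hahn" "h \<in> carrier hahn" "k \<in> carrier hahn"
  note [simp] = this[THEN hahn_coeff_closed]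
  show "f \<oplus>\<^bsub>hahn\<^esub> h \<oplus>\<^bsub>hahn\<^esub> k = f \<oplus>\<^bsub>hahn\<^esub> (h \<oplus>\<^bsub>hahn\<^esub> k)"
    by (simp add: hahn_simps a_assoc)
next
  fix f :: "'g \<Rightarrow> 'a"
  assume f: "f \<in> carrier hahn"
  note [simp] = f[THEN hahn_coeff_closed]
  show "\<zero>\<^bsub>hahn\<^esub> \<oplus>\<^bsub>hahn\<^esub> f = f" by (simp add: hahn_simps)
  have "(\<lambda>g. \<ominus> f g) \<in> carrier hahn"
    using f by (auto simp: hahn_simps elim!: wfp_on_subset)
  moreover have "(\<lambda>g. \<ominus> f g) \<oplus>\<^bsub>hahn\<^esub> f = \<zero>\<^bsub>hahn\<^esub>" by (simp add: hahn_simps l_neg)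
  ultimately show "\<exists>h\<in>carrier hahn. h \<oplus>\<^bsub>hahn\<^esub> f = \<zero>\<^bsub>hahn\<^esub>" by blast
qed

definition monom_series :: "'a \<Rightarrow> 'g \<Rightarrow> 'g::linordered_ab_group_add \<Rightarrow> 'a" where
  "monom_series c g = (\<lambda>x. if x = g then c else \<zero>)"

lemma monom_series_closed: "c \<in> carrier R \<Longrightarrow> monom_series c g \<in> carrier hahn"
  by (auto simp: hahn_simps monom_series_def
      intro!: wfp_on_less_finite finite_subset[of _ "{g}"] split: if_splits)

lemma monom_series_mult:
  assumes "c \<in> carrier R" "f \<in> carrier hahn"
  shows "(monom_series c g \<otimes>\<^bsub>hahn\<^esub> f) x = c \<otimes> f (x - g)"
proof -
  have "(monom_series c g \<otimes>\<^bsub>hahn\<^esub> f) x = (\<Oplus>a\<in>{g}. monom_series c g a \<otimes> f (x - a))"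
    by (rule hahn_mult_coeff)
      (use assms monom_series_closed in \<open>auto simp: monom_series_def split: if_splits\<close>)
  then show ?thesis
    using assms hahn_coeff_closed[OF assms(2)] by (simp add: monom_series_def)
qed

lemma hahn_one_eq_monom_series: "\<one>\<^bsub>hahn\<^esub> = monom_series \<one> 0"
  by (simp add: hahn_simps monom_series_def)

lemma hahn_cring: "cring (hahn :: ('g::linordered_ab_group_add \<Rightarrow> 'a) ring)"
proof (rule cringI)
  show "abelian_group (hahn :: ('g \<Rightarrow> 'a) ring)" by (rule hahn_abelian_group)
  then interpret H: abelian_group "hahn :: ('g \<Rightarrow> 'a) ring" .
  show "comm_monoid (hahn :: ('g \<Rightarrow> 'a) ring)"
  proof (rule comm_monoidI)
    show "\<one>\<^bsub>hahn\<^esub> \<otimes>\<^bsub>hahn\<^esub> f = f" if "f \<in> carrier hahn" for f :: "'g \<Rightarrow> 'a"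
      unfolding hahn_one_eq_monom_series using that hahn_coeff_closed[OF that]
      by (simp add: fun_eq_iff monom_series_mult)
    show "\<one>\<^bsub>hahn\<^esub> \<in> carrier (hahn :: ('g \<Rightarrow> 'a) ring)"
      by (simp add: hahn_one_eq_monom_series monom_series_closed)
  qed (use hahn_mult_closed hahn_mult_assoc hahn_mult_comm in blast)+
qed (use hahn_mult_add_distrib hahn_abelian_group in \<open>auto intro: abelian_groupE(1)\<close>)

lemma hahn_uminus_coeff:
  fixes f :: "'g::linordered_ab_group_add \<Rightarrow> 'a"
  assumes f: "f \<in> carrier hahn"
  shows "(\<ominus>\<^bsub>hahn\<^esub> f) g = \<ominus> f g"
proof -
  interpret H: cring "hahn :: ('g \<Rightarrow> 'a) ring" by (rule hahn_cring)
  have "\<ominus>\<^bsub>hahn\<^esub> f \<oplus>\<^bsub>hahn\<^esub> f = \<zero>\<^bsub>hahn\<^esub>" using f by (rule H.l_neg)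
  then have "(\<ominus>\<^bsub>hahn\<^esub> f) g \<oplus> f g = \<zero>" by (simp add: hahn_zero hahn_add fun_eq_iff)
  then show ?thesis
    using hahn_coeff_closed[OF f] hahn_coeff_closed[OF H.a_inv_closed[OF f]] minus_equality by metis
qed

lemma hahn_minus_coeff:
  "h \<in> carrier hahn \<Longrightarrow> (f \<ominus>\<^bsub>hahn\<^esub> h) g = f g \<ominus> h g"
  by (simp add: a_minus_def hahn_add hahn_uminus_coeff)

definition hahn_val :: "('g::linordered_ab_group_add \<Rightarrow> 'a) \<Rightarrow> 'g" where
  "hahn_val f = (LEAST g. f g \<noteq> \<zero>)"

lemma
  assumes "f \<in> carrier hahn" "f \<noteq> \<zero>\<^bsub>hahn\<^esub>"
  shows hahn_val_coeff: "f (hahn_val f) \<noteq> \<zero>" and hahn_val_le: "f g \<noteq> \<zero> \<Longrightarrow> hahn_val f \<le> g"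
proof -
  have "supp f \<noteq> {}" "wfp_on (supp f) (<)"
    using assms by (auto simp: hahn_carrier_iff hahn_zero)
  then obtain m where m: "f m \<noteq> \<zero>" "\<And>g. f g \<noteq> \<zero> \<Longrightarrow> m \<le> g"
    using wfp_on_less_least[of "supp f" "supp f"] by auto
  then have "hahn_val f = m"
    unfolding hahn_val_def by (rule Least_equality)
  then show "f (hahn_val f) \<noteq> \<zero>" "f g \<noteq> \<zero> \<Longrightarrow> hahn_val f \<le> g" using m by auto
qed

lemma hahn_mult_lowest_coeff:
  assumes f: "f \<in> carrier hahn" "\<And>g. f g \<noteq> \<zero> \<Longrightarrow> \<alpha> \<le> g"
    and h: "h \<in> carrier hahn" "\<And>g. h g \<noteq> \<zero> \<Longrightarrow> \<beta> \<le> g"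
  shows "(f \<otimes>\<^bsub>hahn\<^esub> h) (\<alpha> + \<beta>) = f \<alpha> \<otimes> h \<beta>"
proof -
  have "a = \<alpha>" if "f a \<noteq> \<zero>" "h (\<alpha> + \<beta> - a) \<noteq> \<zero>" for a
    using f(2)[OF that(1)] h(2)[OF that(2)] by (simp add: algebra_simps)
  then have "(f \<otimes>\<^bsub>hahn\<^esub> h) (\<alpha> + \<beta>) = (\<Oplus>a\<in>{\<alpha>}. f a \<otimes> h (\<alpha> + \<beta> - a))"
    by (intro hahn_mult_coeff f h) auto
  then show ?thesis
    using hahn_coeff_closed[OF f(1)] hahn_coeff_closed[OF h(1)] by simp
qed

lemma hahn_val_mult:
  assumes f: "f \<in> carrier hahn" "f \<noteq> \<zero>\<^bsub>hahn\<^esub>" and h: "h \<in> carrier hahn" "h \<noteq> \<zero>\<^bsub>hahn\<^esub>"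
  shows "hahn_val (f \<otimes>\<^bsub>hahn\<^esub> h) = hahn_val f + hahn_val h"
  unfolding hahn_val_def[of "f \<otimes>\<^bsub>hahn\<^esub> h"]
proof (rule Least_equality)
  show "(f \<otimes>\<^bsub>hahn\<^esub> h) (hahn_val f + hahn_val h) \<noteq> \<zero>"
    using hahn_mult_lowest_coeff[OF f(1) hahn_val_le[OF f] h(1) hahn_val_le[OF h]]
      hahn_val_coeff[OF f] hahn_val_coeff[OF h]
      hahn_coeff_closed[OF f(1)] hahn_coeff_closed[OF h(1)]
    by (simp add: integral_iff)
  fix g assume "(f \<otimes>\<^bsub>hahn\<^esub> h) g \<noteq> \<zero>"
  then obtain a where "f a \<noteq> \<zero>" "h (g - a) \<noteq> \<zero>" by (rule hahn_mult_nonzero)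
  then have "hahn_val f + hahn_val h \<le> a + (g - a)"
    using hahn_val_le f h by (intro add_mono)
  then show "hahn_val f + hahn_val h \<le> g" by simp
qed

lemma hahn_val_add:
  fixes f h :: "'g::linordered_ab_group_add \<Rightarrow> 'a"
  assumes f: "f \<in> carrier hahn" "f \<noteq> \<zero>\<^bsub>hahn\<^esub>" and h: "h \<in> carrier hahn" "h \<noteq> \<zero>\<^bsub>hahn\<^esub>"
    and sum: "f \<oplus>\<^bsub>hahn\<^esub> h \<noteq> \<zero>\<^bsub>hahn\<^esub>"
  shows "min (hahn_val f) (hahn_val h) \<le> hahn_val (f \<oplus>\<^bsub>hahn\<^esub> h)"
proof -
  interpret H: cring "hahn :: ('g \<Rightarrow> 'a) ring" by (rule hahn_cring)
  let ?g = "hahn_val (f \<oplus>\<^bsub>hahn\<^esub> h)"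
  have "f ?g \<oplus> h ?g \<noteq> \<zero>"
    using hahn_val_coeff[OF H.a_closed[OF f(1) h(1)] sum] by (simp add: hahn_add)
  then have "f ?g \<noteq> \<zero> \<or> h ?g \<noteq> \<zero>" by auto
  then show ?thesis
    using hahn_val_le[OF f] hahn_val_le[OF h] by (metis min.coboundedI1 min.coboundedI2)
qed

lemma hahn_mult_cong_atMost:
  assumes f: "f \<in> carrier hahn" "f \<noteq> \<zero>\<^bsub>hahn\<^esub>" and x: "x \<in> carrier hahn" and y: "y \<in> carrier hahn"
    and eq: "\<And>h. h \<le> g \<Longrightarrow> x h = y h"
  shows "(f \<otimes>\<^bsub>hahn\<^esub> x) (hahn_val f + g) = (f \<otimes>\<^bsub>hahn\<^esub> y) (hahn_val f + g)"
proof -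
  let ?g = "hahn_val f + g"
  have below: "x (?g - a) = y (?g - a)" if "f a \<noteq> \<zero>" for a
    using hahn_val_le[OF f that] by (intro eq) (simp add: algebra_simps)
  let ?A = "{a. f a \<noteq> \<zero> \<and> x (?g - a) \<noteq> \<zero>}"
  have "(f \<otimes>\<^bsub>hahn\<^esub> y) ?g = (\<Oplus>a\<in>?A. f a \<otimes> y (?g - a))"
    by (rule hahn_mult_coeff[OF f(1) y finite_hahn_fibre[OF f(1) x]]) (use below in auto)
  also have "\<dots> = (\<Oplus>a\<in>?A. f a \<otimes> x (?g - a))"
    using hahn_coeff_closed[OF f(1)] hahn_coeff_closed[OF x] below by (intro finsum_cong') auto
  also have "\<dots> = (f \<otimes>\<^bsub>hahn\<^esub> x) ?g"
    by (simp add: hahn_ring_def)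
  finally show ?thesis ..
qed

text \<open>
  Division is Zorn's lemma for series that solve the equation at all exponents reached by their own
  support: a maximal one is a quotient, since otherwise its next term could be added.
\<close>

definition initial_part :: "('g::linordered_ab_group_add \<Rightarrow> 'a) \<Rightarrow> ('g \<Rightarrow> 'a) \<Rightarrow> bool" where
  "initial_part x y \<longleftrightarrow> (\<forall>g h. x g \<noteq> \<zero> \<longrightarrow> h \<le> g \<longrightarrow> x h = y h)"

definition partial_quotients ::
  "('g::linordered_ab_group_add \<Rightarrow> 'a) \<Rightarrow> ('g \<Rightarrow> 'a) \<Rightarrow> ('g \<Rightarrow> 'a) set" where
  "partial_quotients b f = {x \<in> carrier hahn. \<forall>g h. x g \<noteq> \<zero> \<longrightarrow> h \<le> g \<longrightarrow>
     (f \<otimes>\<^bsub>hahn\<^esub> x) (hahn_val f + h) = b (hahn_val f + h)}"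

lemma partial_order_initial_part: "partial_order_on A (relation_of initial_part A)"
proof (rule partial_order_on_relation_ofI)
  fix x y z :: "'g::linordered_ab_group_add \<Rightarrow> 'a"
  show "initial_part x x" by (simp add: initial_part_def)
  show "initial_part x z" if "initial_part x y" "initial_part y z"
    using that unfolding initial_part_def by (metis order_refl)
  show "x = y" if "initial_part x y" "initial_part y x"
    using that unfolding initial_part_def by (metis ext order_refl)
qed

lemma chain_initial_part_union:
  assumes chain: "\<And>x y. x \<in> C \<Longrightarrow> y \<in> C \<Longrightarrow> initial_part x y \<or> initial_part y x"
    and C: "C \<subseteq> carrier hahn"
  obtains u where "u \<in> carrier hahn" "\<And>x. x \<in> C \<Longrightarrow> initial_part x u" "supp u \<subseteq> (\<Union>x\<in>C. supp x)"
proof -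
  define u where "u g = (if \<exists>x\<in>C. x g \<noteq> \<zero> then (SOME x. x \<in> C \<and> x g \<noteq> \<zero>) g else \<zero>)" for g
  have u_cases: "u g = \<zero> \<and> (\<forall>x\<in>C. x g = \<zero>) \<or> (\<exists>x\<in>C. u g = x g \<and> x g \<noteq> \<zero>)" for g
    using someI_ex[of "\<lambda>x. x \<in> C \<and> x g \<noteq> \<zero>"] by (auto simp: u_def)
  have agrees: "x h = u h" if "x \<in> C" "x g \<noteq> \<zero>" "h \<le> g" for x g h
    using u_cases[of h] chain[OF that(1)] that unfolding initial_part_def by (metis order_refl)
  have supp_u: "supp u \<subseteq> (\<Union>x\<in>C. supp x)"
    using u_cases by fastforce
  have "wfp_on (supp u \<inter> {..g}) (<)" if "g \<in> supp u" for g
  proof -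
    obtain x where x: "x \<in> C" "x g \<noteq> \<zero>" using supp_u \<open>g \<in> supp u\<close> by blast
    then have "supp u \<inter> {..g} \<subseteq> supp x" using agrees by fastforce
    then show ?thesis
      using C x(1) wfp_on_subset unfolding hahn_carrier_iff subset_iff by blast
  qed
  then have "wfp_on (supp u) (<)" by (rule wfp_on_less_if_initial_segments)
  moreover have "u g \<in> carrier R" for g
    using u_cases[of g] C hahn_coeff_closed by (metis subsetD zero_closed)
  ultimately have "u \<in> carrier hahn" by (auto simp: hahn_carrier_iff)
  then show thesis using agrees supp_u that by (auto simp: initial_part_def)
qed

lemma partial_quotients_chain_bounded:
  fixes b f :: "'g::linordered_ab_group_add \<Rightarrow> 'a"
  assumes f: "f \<in> carrier hahn" "f \<noteq> \<zero>\<^bsub>hahn\<^esub>"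
    and C: "C \<in> Chains (relation_of initial_part (partial_quotients b f))"
  shows "\<exists>u\<in>partial_quotients b f. \<forall>x\<in>C. initial_part x u"
proof -
  have chain: "initial_part x y \<or> initial_part y x" if "x \<in> C" "y \<in> C" for x y
    using C that by (auto simp: Chains_def relation_of_def)
  have sub: "C \<subseteq> partial_quotients b f"
    using C by (auto simp: Chains_def relation_of_def)
  then have hahn: "C \<subseteq> carrier hahn" by (auto simp: partial_quotients_def)
  obtain u where u: "u \<in> carrier hahn" "\<And>x. x \<in> C \<Longrightarrow> initial_part x u" "supp u \<subseteq> (\<Union>x\<in>C. supp x)"
    using chain_initial_part_union[OF chain hahn] by blast
  have "(f \<otimes>\<^bsub>hahn\<^esub> u) (hahn_val f + h) = b (hahn_val f + h)" if g: "u g \<noteq> \<zero>" "h \<le> g" for g h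
  proof -
    obtain x where x: "x \<in> C" "x g \<noteq> \<zero>" using u(3) g(1) by blast
    have "(f \<otimes>\<^bsub>hahn\<^esub> u) (hahn_val f + h) = (f \<otimes>\<^bsub>hahn\<^esub> x) (hahn_val f + h)"
    proof (rule hahn_mult_cong_atMost[OF f u(1)])
      show "x \<in> carrier hahn" using x(1) hahn by blast
      show "u h' = x h'" if "h' \<le> h" for h'
        using u(2)[OF x(1)] x(2) g(2) that unfolding initial_part_def by (metis order_trans)
    qed
    also have "\<dots> = b (hahn_val f + h)"
      using sub x g(2) by (auto simp: partial_quotients_def)
    finally show ?thesis .
  qed
  then have "u \<in> partial_quotients b f" using u(1) by (auto simp: partial_quotients_def)
  then show ?thesis using u(2) by blast
qed

lemma hahn_mult_add_monom_coeff:
  fixes f x :: "'g::linordered_ab_group_add \<Rightarrow> 'a"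
  assumes "f \<in> carrier hahn" "x \<in> carrier hahn" "c \<in> carrier R"
  shows "(f \<otimes>\<^bsub>hahn\<^esub> (x \<oplus>\<^bsub>hahn\<^esub> monom_series c m)) g = (f \<otimes>\<^bsub>hahn\<^esub> x) g \<oplus> c \<otimes> f (g - m)"
proof -
  interpret H: cring "hahn :: ('g \<Rightarrow> 'a) ring" by (rule hahn_cring)
  have "f \<otimes>\<^bsub>hahn\<^esub> (x \<oplus>\<^bsub>hahn\<^esub> monom_series c m) =
      f \<otimes>\<^bsub>hahn\<^esub> x \<oplus>\<^bsub>hahn\<^esub> monom_series c m \<otimes>\<^bsub>hahn\<^esub> f"
    using assms(1,2) monom_series_closed[OF assms(3), of m] by algebra
  then show ?thesis
    by (simp add: hahn_add monom_series_mult[OF assms(3,1)])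
qed

lemma partial_quotients_supp_less:
  assumes x: "x \<in> partial_quotients b f" "x g \<noteq> \<zero>"
    and m: "(f \<otimes>\<^bsub>hahn\<^esub> x) (hahn_val f + m) \<noteq> b (hahn_val f + m)"
  shows "g < m"
  using assms unfolding partial_quotients_def by (metis (mono_tags, lifting) mem_Collect_eq not_le)

lemma leading_monom_quotient:
  assumes f: "f \<in> carrier hahn" "f \<noteq> \<zero>\<^bsub>hahn\<^esub>" and d: "d \<in> carrier hahn" "d \<noteq> \<zero>\<^bsub>hahn\<^esub>"
  obtains c where "c \<in> carrier R" "c \<noteq> \<zero>"
    "\<And>g. g \<le> hahn_val d \<Longrightarrow> c \<otimes> f (g - (hahn_val d - hahn_val f)) = d g"
proof -
  note [simp] = hahn_coeff_closed[OF f(1)] hahn_coeff_closed[OF d(1)]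
  define c where "c = d (hahn_val d) \<otimes> inv (f (hahn_val f))"
  have unit: "f (hahn_val f) \<in> Units R" and d_leading: "d (hahn_val d) \<noteq> \<zero>"
    using hahn_val_coeff[OF f] hahn_val_coeff[OF d] by (auto simp: field_Units)
  then have c: "c \<in> carrier R" "c \<otimes> f (hahn_val f) = d (hahn_val d)"
    by (simp_all add: c_def m_assoc)
  have "c \<otimes> f (g - (hahn_val d - hahn_val f)) = d g" if "g \<le> hahn_val d" for g
  proof (cases "g = hahn_val d")
    case False
    then have "g - (hahn_val d - hahn_val f) < hahn_val f" "g < hahn_val d"
      using that by (simp_all add: algebra_simps)
    then have "f (g - (hahn_val d - hahn_val f)) = \<zero>" "d g = \<zero>"
      using hahn_val_le[OF f] hahn_val_le[OF d] by (meson leD)+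
    then show ?thesis using c(1) by simp
  qed (simp add: c(2))
  moreover have "c \<noteq> \<zero>" using c(2) d_leading by auto
  ultimately show thesis using c(1) that by blast
qed

lemma partial_quotients_extend:
  fixes b f :: "'g::linordered_ab_group_add \<Rightarrow> 'a"
  assumes b: "b \<in> carrier hahn" and f: "f \<in> carrier hahn" "f \<noteq> \<zero>\<^bsub>hahn\<^esub>"
    and x: "x \<in> partial_quotients b f" and ne: "f \<otimes>\<^bsub>hahn\<^esub> x \<noteq> b"
  shows "\<exists>y\<in>partial_quotients b f. initial_part x y \<and> y \<noteq> x"
proof -
  interpret H: cring "hahn :: ('g \<Rightarrow> 'a) ring" by (rule hahn_cring)
  have x_hahn: "x \<in> carrier hahn" using x by (simp add: partial_quotients_def)
  define d where "d = b \<ominus>\<^bsub>hahn\<^esub> f \<otimes>\<^bsub>hahn\<^esub> x"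
  have d: "d \<in> carrier hahn" "d \<noteq> \<zero>\<^bsub>hahn\<^esub>"
    unfolding d_def using b f x_hahn ne by auto
  have "f \<otimes>\<^bsub>hahn\<^esub> x \<oplus>\<^bsub>hahn\<^esub> d = b" unfolding d_def using b f x_hahn by algebra
  then have remainder: "(f \<otimes>\<^bsub>hahn\<^esub> x) g \<oplus> d g = b g" for g
    by (simp add: hahn_add fun_eq_iff)
  define m where "m = hahn_val d - hahn_val f"
  obtain c where c: "c \<in> carrier R" "c \<noteq> \<zero>" "\<And>g. g \<le> hahn_val d \<Longrightarrow> c \<otimes> f (g - m) = d g"
    unfolding m_def using leading_monom_quotient[OF f d] by blast
  have "(f \<otimes>\<^bsub>hahn\<^esub> x) (hahn_val f + m) \<noteq> b (hahn_val f + m)"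
    using remainder[of "hahn_val d"] hahn_val_coeff[OF d] hahn_coeff_closed[OF d(1)]
      hahn_coeff_closed[OF b]
    by (auto simp: m_def)
  then have supp_x: "g < m" if "x g \<noteq> \<zero>" for g
    using partial_quotients_supp_less[OF x that] by blast
  define y where "y = x \<oplus>\<^bsub>hahn\<^esub> monom_series c m"
  have y_hahn: "y \<in> carrier hahn"
    unfolding y_def using x_hahn c(1) monom_series_closed by blast
  have y: "y g = (if g = m then c else x g)" for g
    using supp_x[of m] c(1) hahn_coeff_closed[OF x_hahn]
    by (auto simp: y_def hahn_add monom_series_def)
  have "(f \<otimes>\<^bsub>hahn\<^esub> y) (hahn_val f + h) = b (hahn_val f + h)" if "h \<le> m" for h
    using that c(3)[of "hahn_val f + h"] remainder[of "hahn_val f + h"]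
    by (simp add: y_def hahn_mult_add_monom_coeff[OF f(1) x_hahn c(1)] m_def algebra_simps)
  moreover have "g \<le> m" if "y g \<noteq> \<zero>" for g
    using that supp_x[of g] by (auto simp: y split: if_splits)
  ultimately have "y \<in> partial_quotients b f"
    using y_hahn unfolding partial_quotients_def by (auto intro: order_trans)
  moreover have "initial_part x y"
    using supp_x unfolding initial_part_def y by (metis leD)
  moreover have "y \<noteq> x" using supp_x[of m] c(2) y[of m] by auto
  ultimately show ?thesis by blast
qed

lemma hahn_quotient_exists:
  assumes "b \<in> carrier hahn" "f \<in> carrier hahn" "f \<noteq> \<zero>\<^bsub>hahn\<^esub>"
  shows "\<exists>x\<in>carrier hahn. f \<otimes>\<^bsub>hahn\<^esub> x = b"
proof -
  obtain x where x: "x \<in> partial_quotients b f"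
      "\<And>y. y \<in> partial_quotients b f \<Longrightarrow> initial_part x y \<Longrightarrow> y = x"
    using predicate_Zorn[OF partial_order_initial_part
        partial_quotients_chain_bounded[OF assms(2,3)]]
    by blast
  then have "f \<otimes>\<^bsub>hahn\<^esub> x = b" using partial_quotients_extend[OF assms x(1)] by blast
  then show ?thesis using x(1) by (auto simp: partial_quotients_def)
qed

lemma field_hahn: "field (hahn :: ('g::linordered_ab_group_add \<Rightarrow> 'a) ring)"
proof -
  interpret H: cring "hahn :: ('g \<Rightarrow> 'a) ring" by (rule hahn_cring)
  show ?thesis
  proof (rule H.cring_fieldI2)
    show "\<zero>\<^bsub>hahn\<^esub> \<noteq> (\<one>\<^bsub>hahn\<^esub> :: 'g \<Rightarrow> 'a)"
      by (auto simp: hahn_simps dest: fun_cong[where x = 0])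
  qed (use hahn_quotient_exists in blast)
qed

end

section \<open>Valued fields\<close>

locale valued_field = field R for R (structure) +
  fixes v :: "'a \<Rightarrow> 'g::linordered_ab_group_add"
  assumes v_mult: "\<lbrakk>x \<in> carrier R; y \<in> carrier R; x \<noteq> \<zero>; y \<noteq> \<zero>\<rbrakk> \<Longrightarrow> v (x \<otimes> y) = v x + v y"
    and v_add: "\<lbrakk>x \<in> carrier R; y \<in> carrier R; x \<noteq> \<zero>; y \<noteq> \<zero>; x \<oplus> y \<noteq> \<zero>\<rbrakk> \<Longrightarrow>
      min (v x) (v y) \<le> v (x \<oplus> y)"
begin

lemma inv_nonzero: "x \<in> carrier R \<Longrightarrow> x \<noteq> \<zero> \<Longrightarrow> inv x \<in> carrier R \<and> inv x \<noteq> \<zero>"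
  by (metis Diff_iff Units_inv_Units field_Units singleton_iff)

lemma mult_inv: "x \<in> carrier R \<Longrightarrow> x \<noteq> \<zero> \<Longrightarrow> x \<otimes> inv x = \<one>"
  by (simp add: field_Units)

lemma v_one: "v \<one> = 0"
  using v_mult[of \<one> \<one>] by simp

lemma v_uminus:
  assumes "x \<in> carrier R" "x \<noteq> \<zero>"
  shows "v (\<ominus> x) = v x"
proof -
  have nonzero: "\<ominus> \<one> \<noteq> \<zero>" by (metis add.inv_eq_1_iff one_closed one_not_zero)
  have "v (\<ominus> \<one>) + v (\<ominus> \<one>) = v (\<ominus> \<one> \<otimes> \<ominus> \<one>)" using nonzero by (simp add: v_mult)
  also have "\<ominus> \<one> \<otimes> \<ominus> \<one> = \<one>" by (simp add: l_minus)
  finally have "v (\<ominus> \<one>) = 0" by (simp add: v_one)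
  moreover have "v (\<ominus> \<one> \<otimes> x) = v (\<ominus> \<one>) + v x" using nonzero assms by (simp add: v_mult)
  ultimately show ?thesis using assms by (simp add: l_minus)
qed

lemma v_inv:
  assumes "x \<in> carrier R" "x \<noteq> \<zero>"
  shows "v (inv x) = - v x"
  using v_mult[of x "inv x"] assms inv_nonzero[OF assms] mult_inv[OF assms]
  by (simp add: v_one eq_neg_iff_add_eq_0 add.commute)

definition closed_ball :: "'g \<Rightarrow> 'a set" where
  "closed_ball g = {x \<in> carrier R. x = \<zero> \<or> g \<le> v x}"

abbreviation valuation_ring :: "'a set" where
  "valuation_ring \<equiv> closed_ball 0"

lemma closed_ball_carrier: "x \<in> closed_ball g \<Longrightarrow> x \<in> carrier R"
  by (simp add: closed_ball_def)

lemma closed_ball_antimono: "g \<le> h \<Longrightarrow> closed_ball h \<subseteq> closed_ball g"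
  by (auto simp: closed_ball_def intro: order_trans)

lemma closed_ball_nonzero: "x \<in> carrier R \<Longrightarrow> x \<noteq> \<zero> \<Longrightarrow> x \<in> closed_ball g \<longleftrightarrow> g \<le> v x"
  by (simp add: closed_ball_def)

lemma zero_in_closed_ball: "\<zero> \<in> closed_ball g"
  by (simp add: closed_ball_def)

lemma one_in_valuation_ring: "\<one> \<in> valuation_ring"
  by (simp add: closed_ball_def v_one)

lemma closed_ball_mult: "x \<in> closed_ball g \<Longrightarrow> y \<in> closed_ball h \<Longrightarrow> x \<otimes> y \<in> closed_ball (g + h)"
  by (cases "x = \<zero> \<or> y = \<zero>") (auto simp: closed_ball_def v_mult add_mono)

lemma closed_ball_uminus: "x \<in> closed_ball g \<Longrightarrow> \<ominus> x \<in> closed_ball g"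
  by (cases "x = \<zero>") (auto simp: closed_ball_def v_uminus)

lemma closed_ball_add:
  assumes "x \<in> closed_ball g" "y \<in> closed_ball g"
  shows "x \<oplus> y \<in> closed_ball g"
proof (cases "x = \<zero> \<or> y = \<zero> \<or> x \<oplus> y = \<zero>")
  case True
  then show ?thesis using assms by (auto simp: closed_ball_def)
next
  case False
  then have "g \<le> min (v x) (v y)" using assms by (simp add: closed_ball_def)
  also have "\<dots> \<le> v (x \<oplus> y)" using False assms by (intro v_add) (auto simp: closed_ball_def)
  finally show ?thesis using assms by (simp add: closed_ball_def)
qed

lemma closed_ball_minus: "x \<in> closed_ball g \<Longrightarrow> y \<in> closed_ball g \<Longrightarrow> x \<ominus> y \<in> closed_ball g"
  unfolding a_minus_def by (intro closed_ball_add closed_ball_uminus)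

lemma subring_valuation_ring: "subring valuation_ring R"
  by (rule subringI)
    (use closed_ball_mult[of _ 0 _ 0] in
      \<open>auto intro: closed_ball_carrier closed_ball_add closed_ball_uminus one_in_valuation_ring\<close>)

lemma closed_ball_divide:
  assumes "r \<in> carrier R" "r \<noteq> \<zero>" "x \<in> closed_ball (v r)"
  shows "inv r \<otimes> x \<in> valuation_ring" "r \<otimes> (inv r \<otimes> x) = x"
proof -
  have "inv r \<in> closed_ball (- v r)"
    using inv_nonzero[OF assms(1,2)] v_inv[OF assms(1,2)] by (simp add: closed_ball_def)
  then show "inv r \<otimes> x \<in> valuation_ring"
    using closed_ball_mult[OF _ assms(3)] by fastforce
  show "r \<otimes> (inv r \<otimes> x) = x"
    using assms inv_nonzero[OF assms(1,2)] closed_ball_carrier[OF assms(3)]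
    by (simp add: mult_inv flip: m_assoc)
qed

lemma principal_valuation_ring:
  assumes "r \<in> carrier R" "r \<noteq> \<zero>"
  shows "principal R valuation_ring r = closed_ball (v r)"
proof (intro equalityI subsetI)
  fix x assume "x \<in> principal R valuation_ring r"
  then obtain y where y: "x = r \<otimes> y" "y \<in> valuation_ring" by (auto simp: principal_def)
  moreover have "r \<in> closed_ball (v r)" using assms(1) by (simp add: closed_ball_def)
  ultimately show "x \<in> closed_ball (v r)" using closed_ball_mult[of r "v r" y 0] by simp
next
  fix x assume "x \<in> closed_ball (v r)"
  then show "x \<in> principal R valuation_ring r"
    using closed_ball_divide[OF assms] unfolding principal_def by force
qed

lemma rdvd_valuation_ring:
  assumes "a \<in> carrier R" "a \<noteq> \<zero>" "b \<in> carrier R" "b \<noteq> \<zero>"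
  shows "rdvd R valuation_ring a b \<longleftrightarrow> v a \<le> v b"
proof -
  have "rdvd R valuation_ring a b \<longleftrightarrow> b \<in> principal R valuation_ring a"
    by (auto simp: rdvd_def principal_def)
  then show ?thesis using assms by (simp add: principal_valuation_ring closed_ball_nonzero)
qed

lemma Units_valuation_ring:
  "Units (R\<lparr>carrier := valuation_ring\<rparr>) = {x \<in> carrier R. x \<noteq> \<zero> \<and> v x = 0}"
proof (intro equalityI subsetI)
  fix x assume "x \<in> Units (R\<lparr>carrier := valuation_ring\<rparr>)"
  then obtain y where xy: "x \<in> valuation_ring" "y \<in> valuation_ring" "x \<otimes> y = \<one>"
    by (auto simp: Units_def)
  then have nonzero: "x \<noteq> \<zero>" "y \<noteq> \<zero>" and carrier: "x \<in> carrier R" "y \<in> carrier R"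
    by (auto simp: closed_ball_def)
  then have "v x + v y = 0" using v_mult[of x y] xy(3) by (simp add: v_one)
  then show "x \<in> {x \<in> carrier R. x \<noteq> \<zero> \<and> v x = 0}"
    using xy(1,2) nonzero carrier by (simp add: closed_ball_nonzero add_nonneg_eq_0_iff)
next
  fix x assume "x \<in> {x \<in> carrier R. x \<noteq> \<zero> \<and> v x = 0}"
  then have x: "x \<in> carrier R" "x \<noteq> \<zero>" "v x = 0" by auto
  then have "inv x \<in> valuation_ring" "inv x \<otimes> x = \<one>" "x \<otimes> inv x = \<one>" "x \<in> valuation_ring"
    using v_inv inv_nonzero by (auto simp: closed_ball_def field_Units)
  then show "x \<in> Units (R\<lparr>carrier := valuation_ring\<rparr>)" by (auto simp: Units_def)
qed

lemma max_ideal_valuation_ring: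
  "max_ideal R valuation_ring = {x \<in> carrier R. x = \<zero> \<or> 0 < v x}"
  unfolding max_ideal_def Units_valuation_ring by (auto simp: closed_ball_def)

lemma valuation_domain_valuation_ring: "valuation_domain (R\<lparr>carrier := valuation_ring\<rparr>)"
  unfolding valuation_domain_def
proof (intro conjI allI impI)
  show "domain (R\<lparr>carrier := valuation_ring\<rparr>)"
    by (rule subring_is_domain[OF subring_valuation_ring])
  fix I J
  assume I: "ideal I (R\<lparr>carrier := valuation_ring\<rparr>)" and J: "ideal J (R\<lparr>carrier := valuation_ring\<rparr>)"
  have absorb: "y \<in> L" if L: "ideal L (R\<lparr>carrier := valuation_ring\<rparr>)" "x \<in> L" "x \<noteq> \<zero>"
    "x \<in> carrier R" and y: "y \<in> closed_ball (v x)" for L x y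
    using ideal.I_r_closed[OF L(1,2), of "inv x \<otimes> y"] closed_ball_divide[OF L(4,3) y] by simp
  have zero: "\<zero> \<in> I" "\<zero> \<in> J"
    using additive_subgroup.zero_closed[OF ideal.axioms(1)] I J by fastforce+
  have sub: "I \<subseteq> valuation_ring" "J \<subseteq> valuation_ring"
    using additive_subgroup.a_subset[OF ideal.axioms(1)] I J by fastforce+
  show "I \<subseteq> J \<or> J \<subseteq> I"
  proof (rule ccontr)
    assume "\<not> (I \<subseteq> J \<or> J \<subseteq> I)"
    then obtain x y where xy: "x \<in> I" "x \<notin> J" "y \<in> J" "y \<notin> I" by blast
    then have carrier: "x \<in> carrier R" "y \<in> carrier R" and nonzero: "x \<noteq> \<zero>" "y \<noteq> \<zero>"
      using sub zero by (auto simp: closed_ball_def)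
    then have "y \<in> closed_ball (v x) \<or> x \<in> closed_ball (v y)"
      by (auto simp: closed_ball_nonzero)
    then show False
      using absorb[OF I xy(1)] absorb[OF J xy(3)] xy carrier nonzero by blast
  qed
qed

lemma valuation_domain_in_valuation_ring:
  assumes "x \<in> carrier R" "x \<noteq> \<zero>" "v x < 0"
  shows "valuation_domain_in R valuation_ring"
  unfolding valuation_domain_in_def quotient_field_of_def
proof (intro conjI ballI)
  show "field R" by (rule field_axioms)
  show "valuation_ring \<noteq> carrier R"
    using closed_ball_nonzero[OF assms(1,2), of 0] assms(1,3) by auto
  fix y assume y: "y \<in> carrier R"
  show "\<exists>a\<in>valuation_ring. \<exists>b\<in>valuation_ring. b \<noteq> \<zero> \<and> y = a \<otimes> inv b"
  proof (cases "y \<in> valuation_ring")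
    case True
    then show ?thesis
      using y one_in_valuation_ring by (intro bexI[of _ y] bexI[of _ \<one>]) auto
  next
    case False
    then have nonzero: "y \<noteq> \<zero>" and neg: "v y < 0" using y by (auto simp: closed_ball_def)
    have inv: "inv y \<in> carrier R" "inv y \<noteq> \<zero>" using inv_nonzero[OF y nonzero] by auto
    then have "inv y \<in> valuation_ring"
      using v_inv[OF y nonzero] neg by (simp add: closed_ball_nonzero)
    moreover have "y = \<one> \<otimes> inv (inv y)" using y nonzero by (simp add: field_Units)
    ultimately show ?thesis using inv(2) one_in_valuation_ring by blast
  qed
qed (rule subring_valuation_ring valuation_domain_valuation_ring)+

lemma residue_field_isoI:
  assumes "ring K" and hom: "\<rho> \<in> ring_hom (R\<lparr>carrier := valuation_ring\<rparr>) K"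
    and surj: "\<rho> ` valuation_ring = carrier K"
    and kernel: "\<And>x. x \<in> valuation_ring \<Longrightarrow> \<rho> x = \<zero>\<^bsub>K\<^esub> \<longleftrightarrow> x = \<zero> \<or> 0 < v x"
  shows "residue_field R valuation_ring \<simeq> K"
proof -
  interpret \<rho>: ring_hom_ring "R\<lparr>carrier := valuation_ring\<rparr>" K \<rho>
    using subring_is_ring[OF subring_valuation_ring] assms(1) hom by (rule ring_hom_ringI2)
  have "a_kernel (R\<lparr>carrier := valuation_ring\<rparr>) K \<rho> = max_ideal R valuation_ring"
    unfolding a_kernel_def' max_ideal_valuation_ring
    using kernel by (auto simp: closed_ball_def less_imp_le)
  then show ?thesis
    unfolding residue_field_def using \<rho>.FactRing_iso surj by simp
qed

lemma rspan_subset_closed_ball: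
  assumes "S \<subseteq> closed_ball g"
  shows "rspan R valuation_ring S \<subseteq> closed_ball g"
proof
  fix x assume "x \<in> rspan R valuation_ring S"
  then obtain F c where F: "x = (\<Oplus>s\<in>F. c s \<otimes> s)" "finite F" "F \<subseteq> S" "c \<in> F \<rightarrow> valuation_ring"
    unfolding rspan_def by blast
  have "(\<Oplus>s\<in>F. c s \<otimes> s) \<in> closed_ball g"
    using F(2-4)
  proof (induction F rule: finite_induct)
    case (insert s F)
    then have terms: "c t \<otimes> t \<in> closed_ball g" if "t \<in> insert s F" for t
      using closed_ball_mult[of "c t" 0 t g] assms that by auto
    then have "(\<Oplus>t\<in>insert s F. c t \<otimes> t) = c s \<otimes> s \<oplus> (\<Oplus>t\<in>F. c t \<otimes> t)"
      using insert by (intro finsum_insert) (auto intro: closed_ball_carrier)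
    then show ?case using insert terms by (auto intro: closed_ball_add)
  qed (simp add: zero_in_closed_ball)
  then show "x \<in> closed_ball g" using F(1) by simp
qed

lemma rspan_carrier: "rspan R valuation_ring (carrier R) = carrier R"
proof (intro equalityI subsetI)
  fix x assume "x \<in> rspan R valuation_ring (carrier R)"
  then show "x \<in> carrier R"
    unfolding rspan_def by (auto intro!: finsum_closed dest: closed_ball_carrier simp: Pi_iff)
next
  fix x assume "x \<in> carrier R"
  then have "x = (\<Oplus>s\<in>{x}. \<one> \<otimes> s)" by (simp add: finsum_insert)
  then show "x \<in> rspan R valuation_ring (carrier R)"
    unfolding rspan_def mem_Collect_eq using \<open>x \<in> carrier R\<close> one_in_valuation_ring
    by (intro exI[of _ "{x}"] exI[of _ "\<lambda>_. \<one>"]) auto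
qed

lemma translate_closed_ball_eq_iff:
  assumes "a \<in> carrier R" "b \<in> carrier R"
  shows "(\<lambda>y. a \<oplus> y) ` closed_ball g = (\<lambda>y. b \<oplus> y) ` closed_ball g \<longleftrightarrow> a \<ominus> b \<in> closed_ball g"
proof
  assume "(\<lambda>y. a \<oplus> y) ` closed_ball g = (\<lambda>y. b \<oplus> y) ` closed_ball g"
  then obtain y where y: "a = b \<oplus> y" "y \<in> closed_ball g"
    using assms zero_in_closed_ball by (metis (no_types, lifting) image_iff r_zero)
  then have "a \<ominus> b = y" using assms closed_ball_carrier[OF y(2)] by (simp add: y(1)) algebra
  then show "a \<ominus> b \<in> closed_ball g" using y(2) by simp
next
  have sub: "(\<lambda>y. a \<oplus> y) ` closed_ball g \<subseteq> (\<lambda>y. b \<oplus> y) ` closed_ball g"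
    if "a \<in> carrier R" "b \<in> carrier R" "a \<ominus> b \<in> closed_ball g" for a b
  proof clarify
    fix y assume y: "y \<in> closed_ball g"
    have "a \<oplus> y = b \<oplus> ((a \<ominus> b) \<oplus> y)"
      using that(1,2) closed_ball_carrier[OF y] by algebra
    then show "a \<oplus> y \<in> (\<lambda>y. b \<oplus> y) ` closed_ball g"
      using closed_ball_add[OF that(3) y] by blast
  qed
  assume ab: "a \<ominus> b \<in> closed_ball g"
  have "b \<ominus> a = \<ominus> (a \<ominus> b)" using assms by algebra
  then show "(\<lambda>y. a \<oplus> y) ` closed_ball g = (\<lambda>y. b \<oplus> y) ` closed_ball g"
    using sub[OF assms ab] sub[OF assms(2,1)] closed_ball_uminus[OF ab] by (intro equalityI) auto
qed

lemma countable_cosets_inI: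
  assumes "countable (\<tau> ` M)" "M \<subseteq> carrier R"
    and "\<And>x y. x \<in> M \<Longrightarrow> y \<in> M \<Longrightarrow> \<tau> x = \<tau> y \<Longrightarrow> x \<ominus> y \<in> closed_ball g"
  shows "countable (cosets_in R M (closed_ball g))"
proof -
  define coset where "coset a = (\<lambda>y. a \<oplus> y) ` closed_ball g" for a
  have "coset a = coset (inv_into M \<tau> (\<tau> a))" if "a \<in> M" for a
  proof -
    have "inv_into M \<tau> (\<tau> a) \<in> M" "\<tau> (inv_into M \<tau> (\<tau> a)) = \<tau> a"
      using that by (auto intro: inv_into_into f_inv_into_f)
    then show ?thesis
      unfolding coset_def using that assms(2,3) by (subst translate_closed_ball_eq_iff) auto
  qed
  then have "cosets_in R M (closed_ball g) \<subseteq> (\<lambda>t. coset (inv_into M \<tau> t)) ` \<tau> ` M"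
    by (auto simp: cosets_in_def coset_def)
  then show ?thesis using assms(1) by (meson countable_image countable_subset)
qed

lemma uncountable_cosets_inI:
  assumes "uncountable S" "S \<subseteq> M" "M \<subseteq> carrier R"
    and "\<And>x y. x \<in> S \<Longrightarrow> y \<in> S \<Longrightarrow> x \<ominus> y \<in> closed_ball g \<Longrightarrow> x = y"
  shows "uncountable (cosets_in R M (closed_ball g))"
proof
  assume "countable (cosets_in R M (closed_ball g))"
  moreover have "(\<lambda>a. (\<lambda>y. a \<oplus> y) ` closed_ball g) ` S \<subseteq> cosets_in R M (closed_ball g)"
    using assms(2) by (auto simp: cosets_in_def)
  ultimately have "countable ((\<lambda>a. (\<lambda>y. a \<oplus> y) ` closed_ball g) ` S)"
    by (rule countable_subset[rotated])
  moreover have "inj_on (\<lambda>a. (\<lambda>y. a \<oplus> y) ` closed_ball g) S"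
    using assms(2-4) by (intro inj_onI) (auto simp: translate_closed_ball_eq_iff subset_iff)
  ultimately show False using assms(1) countable_image_inj_on by blast
qed

lemma closed_ball_mult_iff:
  assumes "x \<in> carrier R" "b \<in> carrier R" "b \<noteq> \<zero>"
  shows "x \<otimes> b \<in> closed_ball (g + v b) \<longleftrightarrow> x \<in> closed_ball g"
  using assms by (cases "x = \<zero>") (simp_all add: closed_ball_def integral_iff v_mult)

lemma closed_ball_quotient_minus:
  assumes x: "x \<in> carrier R" "y \<in> valuation_ring"
    and b: "b \<in> carrier R" "b \<noteq> \<zero>" "v b = 0" "c \<in> carrier R"
    and close: "x \<otimes> b \<ominus> y \<otimes> c \<in> closed_ball g" "b \<ominus> c \<in> closed_ball g"
  shows "x \<ominus> y \<in> closed_ball g"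
proof -
  have y: "y \<in> carrier R" using x(2) by (rule closed_ball_carrier)
  have "(x \<ominus> y) \<otimes> b = (x \<otimes> b \<ominus> y \<otimes> c) \<ominus> y \<otimes> (b \<ominus> c)"
    using x(1) y b(1,4) by algebra
  also have "\<dots> \<in> closed_ball g"
    using closed_ball_minus[OF close(1)] closed_ball_mult[OF x(2) close(2)] by simp
  finally show ?thesis
    using closed_ball_mult_iff[OF _ b(1,2), of "x \<ominus> y" g] x(1) y b(3) by simp
qed

lemma valued_field_pullback:
  assumes "field Q" "h \<in> ring_hom Q R"
  shows "valued_field Q (v \<circ> h)"
proof -
  interpret Q: field Q by fact
  interpret h: ring_hom_ring Q R h
    using Q.ring_axioms ring_axioms assms(2) by (rule ring_hom_ringI2)
  have nonzero: "h x \<noteq> \<zero>" if "x \<in> carrier Q" "x \<noteq> \<zero>\<^bsub>Q\<^esub>" for x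
    using non_trivial_field_hom_is_inj[OF assms(2,1) field_axioms] that
    by (metis Q.zero_closed h.hom_zero inj_onD)
  show ?thesis
  proof
    fix x y assume xy: "x \<in> carrier Q" "y \<in> carrier Q" "x \<noteq> \<zero>\<^bsub>Q\<^esub>" "y \<noteq> \<zero>\<^bsub>Q\<^esub>"
    then show "(v \<circ> h) (x \<otimes>\<^bsub>Q\<^esub> y) = (v \<circ> h) x + (v \<circ> h) y"
      by (simp add: v_mult nonzero)
    assume "x \<oplus>\<^bsub>Q\<^esub> y \<noteq> \<zero>\<^bsub>Q\<^esub>"
    then show "min ((v \<circ> h) x) ((v \<circ> h) y) \<le> (v \<circ> h) (x \<oplus>\<^bsub>Q\<^esub> y)"
      using v_add[of "h x" "h y"] nonzero[of "x \<oplus>\<^bsub>Q\<^esub> y"] xy by (simp add: nonzero)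
  qed
qed

end

section \<open>Value groups\<close>

definition additive_group :: "'g::ab_group_add monoid" where
  "additive_group = \<lparr>carrier = UNIV, monoid.mult = (+), one = 0\<rparr>"

lemma group_additive_group: "group (additive_group :: 'g::ab_group_add monoid)"
  by (rule groupI) (auto simp: additive_group_def add.assoc intro: exI[of _ "- _"])

context valued_field
begin

lemma
  assumes surj: "v ` (carrier R - {\<zero>}) = UNIV"
  shows group_value_group: "group (value_group R valuation_ring)"
    and value_group_iso:
      "(\<lambda>A. the_elem (v ` A)) \<in> iso (value_group R valuation_ring) additive_group"
proof -
  \<comment> \<open>HOL-Algebra has two constants of this name; the group lemma is about the other one.\<close>
  have "group (mult_of R)"
    using field_mult_group unfolding mult_of_def Multiplicative_Group.mult_of_def .
  then interpret v: group_hom "mult_of R" "additive_group :: 'g monoid" v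
    using group_additive_group
    by (intro group_hom.intro group_hom_axioms.intro homI) (auto simp: additive_group_def v_mult)
  have "kernel (mult_of R) (additive_group :: 'g monoid) v = Units (R\<lparr>carrier := valuation_ring\<rparr>)"
    unfolding kernel_def Units_valuation_ring by (auto simp: additive_group_def)
  then show "group (value_group R valuation_ring)"
    "(\<lambda>A. the_elem (v ` A)) \<in> iso (value_group R valuation_ring) additive_group"
    unfolding value_group_def
    using normal.factorgroup_is_group[OF v.normal_kernel] v.FactGroup_iso_set surj
    by (simp_all add: additive_group_def)
qed

lemma value_group_elem_cases:
  assumes "A \<in> carrier (value_group R valuation_ring)"
  obtains x where "x \<in> A" "\<And>y. y \<in> A \<Longrightarrow> y \<in> carrier R \<and> y \<noteq> \<zero> \<and> v y = the_elem (v ` A)"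
proof -
  obtain x where x: "x \<in> carrier R" "x \<noteq> \<zero>"
      "A = Units (R\<lparr>carrier := valuation_ring\<rparr>) #>\<^bsub>mult_of R\<^esub> x"
    using assms by (auto simp: value_group_def FactGroup_def RCOSETS_def)
  have A: "y \<in> carrier R" "y \<noteq> \<zero>" "v y = v x" if "y \<in> A" for y
    using that x unfolding x(3) r_coset_def Units_valuation_ring
    by (auto simp: integral_iff v_mult)
  have "x = \<one> \<otimes> x" "\<one> \<in> Units (R\<lparr>carrier := valuation_ring\<rparr>)"
    using x(1) by (simp_all add: Units_valuation_ring v_one)
  then have "x \<in> A" unfolding x(3) r_coset_def by auto
  have "v ` A = (\<lambda>_. v x) ` A" using A(3) by (rule image_cong[OF refl])
  also have "\<dots> = {v x}" using \<open>x \<in> A\<close> by (rule image_constant)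
  finally have "the_elem (v ` A) = v x" by simp
  then show thesis using that[OF \<open>x \<in> A\<close>] A by metis
qed

lemma value_le_iff:
  assumes A: "A \<in> carrier (value_group R valuation_ring)"
    and B: "B \<in> carrier (value_group R valuation_ring)"
  shows "value_le R valuation_ring A B \<longleftrightarrow> the_elem (v ` A) \<le> the_elem (v ` B)"
proof -
  have quotient: "b \<otimes> inv a \<in> valuation_ring \<longleftrightarrow> v a \<le> v b"
    if "a \<in> carrier R" "a \<noteq> \<zero>" "b \<in> carrier R" "b \<noteq> \<zero>" for a b
    using that inv_nonzero[of a] v_inv[of a] by (simp add: closed_ball_def integral_iff v_mult)
  obtain a where "a \<in> A" "\<And>y. y \<in> A \<Longrightarrow> y \<in> carrier R \<and> y \<noteq> \<zero> \<and> v y = the_elem (v ` A)"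
    using A by (rule value_group_elem_cases) blast
  moreover obtain b where "b \<in> B" "\<And>y. y \<in> B \<Longrightarrow> y \<in> carrier R \<and> y \<noteq> \<zero> \<and> v y = the_elem (v ` B)"
    using B by (rule value_group_elem_cases) blast
  ultimately show ?thesis unfolding value_le_def using quotient by metis
qed

end

lemma same_value_group_valuation_ring:
  fixes v :: "'a \<Rightarrow> 'g::linordered_ab_group_add" and w :: "'b \<Rightarrow> 'g"
  assumes "valued_field Q v" "v ` (carrier Q - {\<zero>\<^bsub>Q\<^esub>}) = UNIV"
    and "valued_field Q' w" "w ` (carrier Q' - {\<zero>\<^bsub>Q'\<^esub>}) = UNIV"
  shows "same_value_group Q (valued_field.closed_ball Q v 0) Q' (valued_field.closed_ball Q' w 0)"
proof -
  interpret V: valued_field Q v by fact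
  interpret W: valued_field Q' w by fact
  let ?V = "value_group Q V.valuation_ring" and ?W = "value_group Q' W.valuation_ring"
  let ?v = "\<lambda>A. the_elem (v ` A)" and ?w = "\<lambda>A. the_elem (w ` A)"
  have v_iso: "?v \<in> iso ?V additive_group" and w_iso: "?w \<in> iso ?W additive_group"
    using V.value_group_iso W.value_group_iso assms(2,4) by auto
  define \<phi> where "\<phi> = inv_into (carrier ?W) ?w \<circ> ?v"
  have \<phi>_iso: "\<phi> \<in> iso ?V ?W"
    unfolding \<phi>_def using v_iso group.iso_set_sym[OF W.group_value_group[OF assms(4)] w_iso]
    by (rule iso_set_trans)
  have "?w (\<phi> A) = ?v A" for A
    unfolding \<phi>_def comp_def
    by (rule f_inv_into_f) (use w_iso in \<open>simp add: iso_def bij_betw_def additive_group_def\<close>)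
  moreover have "\<phi> A \<in> carrier ?W" if "A \<in> carrier ?V" for A
    using \<phi>_iso that by (auto simp: iso_def hom_def)
  ultimately have "value_le Q V.valuation_ring A B \<longleftrightarrow> value_le Q' W.valuation_ring (\<phi> A) (\<phi> B)"
    if "A \<in> carrier ?V" "B \<in> carrier ?V" for A B
    using that by (simp add: V.value_le_iff W.value_le_iff)
  then show ?thesis unfolding same_value_group_def using \<phi>_iso by blast
qed

section \<open>Valued fields with value group of cofinality \<open>\<omega>\<^sub>1\<close>\<close>

locale omega1_valued_field = valued_field R v + omega1_scale scale
  for R (structure) and v :: "'a \<Rightarrow> 'g::linordered_ab_group_add" and scale :: "nat set \<Rightarrow> 'g" +
  assumes card_le_aleph1_carrier: "card_le_aleph1 (carrier R)"
    and v_surj: "v ` (carrier R - {\<zero>}) = UNIV"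
begin

definition elem_of_value :: "'g \<Rightarrow> 'a" where
  "elem_of_value g = (SOME x. x \<in> carrier R \<and> x \<noteq> \<zero> \<and> v x = g)"

lemma elem_of_value:
  "elem_of_value g \<in> carrier R" "elem_of_value g \<noteq> \<zero>" "v (elem_of_value g) = g"
proof -
  have "\<exists>x. x \<in> carrier R \<and> x \<noteq> \<zero> \<and> v x = g"
    using v_surj by (metis (no_types, lifting) DiffE UNIV_I imageE insertI1)
  then have "elem_of_value g \<in> carrier R \<and> elem_of_value g \<noteq> \<zero> \<and> v (elem_of_value g) = g"
    unfolding elem_of_value_def by (rule someI_ex)
  then show "elem_of_value g \<in> carrier R" "elem_of_value g \<noteq> \<zero>" "v (elem_of_value g) = g" by auto
qed

lemma valuation_domain_in: "valuation_domain_in R valuation_ring"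
  using scale_pos
  by (intro valuation_domain_in_valuation_ring[of "elem_of_value (- scale undefined)"])
    (simp_all add: elem_of_value)

lemma card_eq_aleph1_valuation_ring: "card_eq_aleph1 valuation_ring"
proof -
  have "valuation_ring \<subseteq> carrier R" by (auto dest: closed_ball_carrier)
  then have "|valuation_ring| \<le>o aleph1"
    using card_le_aleph1_subset[OF card_le_aleph1_carrier] unfolding card_le_aleph1_def by blast
  moreover have "|omega1_idx| \<le>o |valuation_ring|"
  proof (rule card_of_ordLeqI)
    show "inj_on (\<lambda>i. elem_of_value (scale i)) omega1_idx"
      by (rule inj_onI) (metis elem_of_value(3) inj_onD inj_on_scale)
    show "elem_of_value (scale i) \<in> valuation_ring" for i
      using scale_pos[of i] by (simp add: elem_of_value closed_ball_nonzero)
  qed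
  then have "aleph1 \<le>o |valuation_ring|"
    by (rule ordIso_ordLeq_trans[OF ordIso_symmetric[OF card_of_omega1_idx]])
  ultimately show ?thesis unfolding card_eq_aleph1_def by (simp add: ordIso_iff_ordLeq)
qed

lemma generated_by_aleph1: "\<exists>S\<subseteq>carrier R. card_le_aleph1 S \<and> rspan R valuation_ring S = carrier R"
  using card_le_aleph1_carrier rspan_carrier by blast

lemma not_countably_generated:
  assumes "S \<subseteq> carrier R" "countable S"
  shows "rspan R valuation_ring S \<noteq> carrier R"
proof
  assume span: "rspan R valuation_ring S = carrier R"
  obtain i where i: "\<And>s. s \<in> S \<Longrightarrow> - v s < scale i"
    using countable_bounded[of "(\<lambda>s. - v s) ` S"] assms(2) by auto
  have "- scale i < v s" if "s \<in> S" for s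
    using i[OF that] by (subst minus_less_iff)
  then have "S \<subseteq> closed_ball (- scale i)"
    using assms(1) by (auto simp: closed_ball_def less_imp_le)
  then have "elem_of_value (- scale i - scale i) \<in> closed_ball (- scale i)"
    using rspan_subset_closed_ball span elem_of_value(1) by blast
  then show False
    using scale_pos[of i] by (simp add: closed_ball_nonzero elem_of_value)
qed

lemma omega1_rep_exists: "\<exists>r. omega1_rep R valuation_ring (carrier R) r"
proof
  let ?r = "\<lambda>i. elem_of_value (scale i)"
  show "omega1_rep R valuation_ring (carrier R) ?r"
    unfolding omega1_rep_def
  proof (intro conjI ballI impI)
    fix i
    show "?r i \<in> valuation_ring"
      using scale_pos[of i] by (simp add: elem_of_value closed_ball_nonzero)
    show "?r i \<noteq> \<zero>" by (rule elem_of_value)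
  next
    fix j i assume "(j, i) \<in> aleph1 \<and> j \<noteq> i"
    then have "scale j < scale i" using scale_less by blast
    then show "rdvd R valuation_ring (?r j) (?r i)" "\<not> rdvd R valuation_ring (?r i) (?r j)"
      by (simp_all add: rdvd_valuation_ring elem_of_value)
  next
    have principal: "principal R valuation_ring (inv (?r i)) = closed_ball (- scale i)" for i
      using inv_nonzero[OF elem_of_value(1,2)] v_inv[OF elem_of_value(1,2)]
      by (simp add: principal_valuation_ring elem_of_value)
    show "carrier R = (\<Union>i\<in>omega1_idx. principal R valuation_ring (inv (?r i)))"
    proof (intro equalityI subsetI)
      fix x assume x: "x \<in> carrier R"
      obtain i where i: "i \<in> omega1_idx" "- v x < scale i" using scale_cofinal by blast
      then have "- scale i < v x" by (subst minus_less_iff)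
      then have "x \<in> principal R valuation_ring (inv (?r i))"
        unfolding principal using x by (simp add: closed_ball_def less_imp_le)
      then show "x \<in> (\<Union>i\<in>omega1_idx. principal R valuation_ring (inv (?r i)))"
        using i(1) by blast
    qed (auto simp: principal dest: closed_ball_carrier)
  qed
qed

lemma omega1_repD:
  assumes "omega1_rep R valuation_ring (carrier R) r" "i \<in> omega1_idx"
  shows "r i \<in> carrier R" "r i \<noteq> \<zero>"
  using assms closed_ball_carrier unfolding omega1_rep_def by blast+

lemma omega1_rep_cofinal:
  assumes r: "omega1_rep R valuation_ring (carrier R) r"
  shows "\<exists>i\<in>omega1_idx. g < v (r i)"
proof -
  let ?z = "elem_of_value (- (g + scale undefined))"
  have "?z \<in> (\<Union>i\<in>omega1_idx. principal R valuation_ring (inv (r i)))"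
    using r elem_of_value(1) by (simp add: omega1_rep_def)
  then obtain i where i: "i \<in> omega1_idx" "?z \<in> principal R valuation_ring (inv (r i))"
    by blast
  note r_i = omega1_repD[OF r i(1)]
  have "- v (r i) \<le> - (g + scale undefined)"
    using i(2) inv_nonzero[OF r_i] v_inv[OF r_i]
    by (simp add: principal_valuation_ring closed_ball_nonzero elem_of_value)
  then have "g + scale undefined \<le> v (r i)" by (simp only: neg_le_iff_le)
  then have "g < v (r i)"
    using scale_pos[of undefined] by (meson less_add_same_cancel1 less_le_trans)
  then show ?thesis using i(1) by blast
qed

lemma omega1_rep_v_less_imp:
  assumes r: "omega1_rep R valuation_ring (carrier R) r"
    and i: "i \<in> omega1_idx" and j: "j \<in> omega1_idx" and less: "v (r i) < v (r j)"
  shows "(i, j) \<in> aleph1 \<and> i \<noteq> j"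
proof -
  have "\<not> rdvd R valuation_ring (r j) (r i)"
    using less omega1_repD[OF r i] omega1_repD[OF r j] by (simp add: rdvd_valuation_ring)
  then have "\<not> ((j, i) \<in> aleph1 \<and> j \<noteq> i)"
    using r i j unfolding omega1_rep_def by blast
  moreover have "i \<noteq> j" using less by blast
  ultimately show ?thesis using aleph1_total[OF i j] by blast
qed

lemma essentially_uncountable_typeI:
  assumes S: "uncountable S" "S \<subseteq> valuation_ring"
    and separated: "\<And>s t. s \<in> S \<Longrightarrow> t \<in> S \<Longrightarrow> s \<ominus> t \<in> closed_ball g \<Longrightarrow> s = t"
  shows "essentially_uncountable_type R valuation_ring (carrier R)"
  unfolding essentially_uncountable_type_def
proof (intro conjI allI impI ballI)
  fix r i assume r: "omega1_rep R valuation_ring (carrier R) r" and i: "i \<in> omega1_idx"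
  note r_i = omega1_repD[OF r i]
  obtain j where j: "j \<in> omega1_idx" "max (v (r i)) (g + v (r i)) < v (r j)"
    using omega1_rep_cofinal[OF r] by blast
  then have less: "v (r i) < v (r j)" "g + v (r i) \<le> v (r j)"
    by (auto simp: less_imp_le)
  note r_j = omega1_repD[OF r j(1)]
  have S_carrier: "s \<in> carrier R" if "s \<in> S" for s
    using that S(2) closed_ball_carrier by blast
  have injective: "s = t"
    if s: "s \<in> S" and t: "t \<in> S" and ball: "r i \<otimes> s \<ominus> r i \<otimes> t \<in> closed_ball (v (r j))" for s t
  proof -
    note carrier = S_carrier[OF s] S_carrier[OF t]
    have "r i \<otimes> s \<ominus> r i \<otimes> t = (s \<ominus> t) \<otimes> r i" using carrier r_i(1) by algebra
    then have "(s \<ominus> t) \<otimes> r i \<in> closed_ball (g + v (r i))"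
      using ball closed_ball_antimono[OF less(2)] by auto
    then show "s = t"
      using separated[OF s t] closed_ball_mult_iff[OF minus_closed[OF carrier] r_i] by blast
  qed
  have "inj_on (\<lambda>s. r i \<otimes> s) S"
    using r_i S_carrier by (intro inj_onI) (simp add: m_lcancel)
  then have "uncountable ((\<lambda>s. r i \<otimes> s) ` S)"
    using S(1) countable_image_inj_on by blast
  then have "uncountable (cosets_in R (principal R valuation_ring (r i)) (closed_ball (v (r j))))"
  proof (rule uncountable_cosets_inI)
    show "(\<lambda>s. r i \<otimes> s) ` S \<subseteq> principal R valuation_ring (r i)"
      using S(2) by (auto simp: principal_def)
    show "principal R valuation_ring (r i) \<subseteq> carrier R"
      using r_i by (auto simp: principal_valuation_ring dest: closed_ball_carrier)
  qed (use injective in blast)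
  then show "\<exists>j\<in>omega1_idx. (i, j) \<in> aleph1 \<and> i \<noteq> j \<and>
      uncountable (cosets_in R (principal R valuation_ring (r i)) (principal R valuation_ring (r j)))"
    using omega1_rep_v_less_imp[OF r i j(1) less(1)] j(1)
    by (auto simp: principal_valuation_ring[OF r_j])
qed (rule omega1_rep_exists)

lemma strongly_countable_typeI:
  assumes "\<And>g. \<exists>approx :: 'a \<Rightarrow> 'c. countable (approx ` valuation_ring) \<and>
    (\<forall>x\<in>valuation_ring. \<forall>y\<in>valuation_ring. approx x = approx y \<longrightarrow> x \<ominus> y \<in> closed_ball g)"
  shows "strongly_countable_type R valuation_ring (carrier R)"
  unfolding strongly_countable_type_def
proof (intro conjI allI impI ballI)
  fix r i assume r: "omega1_rep R valuation_ring (carrier R) r" and i: "i \<in> omega1_idx"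
  obtain approx :: "'a \<Rightarrow> 'c" where "countable (approx ` valuation_ring)"
    "\<And>x y. x \<in> valuation_ring \<Longrightarrow> y \<in> valuation_ring \<Longrightarrow> approx x = approx y \<Longrightarrow>
      x \<ominus> y \<in> closed_ball (v (r i))"
    using assms by metis
  then show "countable (cosets_in R valuation_ring (principal R valuation_ring (r i)))"
    unfolding principal_valuation_ring[OF omega1_repD[OF r i]]
    by (intro countable_cosets_inI[of approx]) (auto dest: closed_ball_carrier)
qed (rule omega1_rep_exists)

end

section \<open>Subfields of the field of Hahn series\<close>

lemma (in field) valued_field_hahn: "valued_field hahn hahn_val"
proof -
  interpret H: field "hahn :: ('g::linordered_ab_group_add \<Rightarrow> 'a) ring" by (rule field_hahn)
  show ?thesis by standard (simp_all add: hahn_val_mult hahn_val_add)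
qed

context field
begin

abbreviation hahn_ball :: "'g::linordered_ab_group_add \<Rightarrow> ('g \<Rightarrow> 'a) set" where
  "hahn_ball \<equiv> valued_field.closed_ball hahn hahn_val"

lemma hahn_ball_iff:
  fixes f :: "'g::linordered_ab_group_add \<Rightarrow> 'a"
  assumes "f \<in> carrier hahn"
  shows "f \<in> hahn_ball g \<longleftrightarrow> supp f \<subseteq> {g..}"
proof -
  interpret H: valued_field "hahn :: ('g \<Rightarrow> 'a) ring" hahn_val by (rule valued_field_hahn)
  show ?thesis
  proof (cases "f = \<zero>\<^bsub>hahn\<^esub>")
    case True
    then show ?thesis by (simp add: H.zero_in_closed_ball) (simp add: hahn_zero)
  next
    case False
    then show ?thesis
      using assms hahn_val_coeff[OF assms False] hahn_val_le[OF assms False]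
      by (auto simp: H.closed_ball_nonzero intro: order_trans)
  qed
qed

lemma hahn_val_monom_series: "c \<noteq> \<zero> \<Longrightarrow> hahn_val (monom_series c g) = g"
  unfolding hahn_val_def by (rule Least_equality) (auto simp: monom_series_def split: if_splits)

lemma monom_series_nonzero: "c \<noteq> \<zero> \<Longrightarrow> monom_series c g \<noteq> \<zero>\<^bsub>hahn\<^esub>"
  by (auto simp: monom_series_def hahn_zero dest: fun_cong[where x = g])

end

locale hahn_embedding = K: field K + Q: field Q + omega1_scale scale
  for K :: "('k, 'e) ring_scheme" and Q :: "('q, 'f) ring_scheme"
    and scale :: "nat set \<Rightarrow> 'g::linordered_ab_group_add" +
  fixes h :: "'q \<Rightarrow> 'g \<Rightarrow> 'k"
  assumes h_hom: "h \<in> ring_hom Q (hahn_ring K)"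
    and monom_series_in_image: "c \<in> carrier K \<Longrightarrow> K.monom_series c g \<in> h ` carrier Q"
    and card_le_aleph1_domain: "card_le_aleph1 (carrier Q)"
begin

interpretation hahn: valued_field "hahn_ring K :: ('g \<Rightarrow> 'k) ring" K.hahn_val
  by (rule K.valued_field_hahn)

sublocale h: ring_hom_ring Q "hahn_ring K" h
  using Q.ring_axioms hahn.ring_axioms h_hom by (rule ring_hom_ringI2)

abbreviation val :: "'q \<Rightarrow> 'g" where "val \<equiv> K.hahn_val \<circ> h"

lemma h_inj: "inj_on h (carrier Q)"
  by (rule non_trivial_field_hom_is_inj[OF h_hom Q.field_axioms hahn.field_axioms])

lemma h_eq_zero_iff: "x \<in> carrier Q \<Longrightarrow> h x = \<zero>\<^bsub>hahn_ring K\<^esub> \<longleftrightarrow> x = \<zero>\<^bsub>Q\<^esub>"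
  using h_inj by (metis Q.zero_closed h.hom_zero inj_onD)

sublocale omega1_valued_field Q val scale
proof (intro omega1_valued_field.intro omega1_valued_field_axioms.intro)
  show "valued_field Q val"
    by (rule hahn.valued_field_pullback[OF Q.field_axioms h_hom])
  show "omega1_scale scale" by (rule omega1_scale_axioms)
  show "card_le_aleph1 (carrier Q)" by (rule card_le_aleph1_domain)
  have "g \<in> val ` (carrier Q - {\<zero>\<^bsub>Q\<^esub>})" for g
  proof -
    obtain x where x: "x \<in> carrier Q" "h x = K.monom_series \<one>\<^bsub>K\<^esub> g"
      using monom_series_in_image[OF K.one_closed] by (metis imageE)
    then have "h x \<noteq> \<zero>\<^bsub>hahn_ring K\<^esub>" "val x = g"
      using K.monom_series_nonzero[OF K.one_not_zero] K.hahn_val_monom_series[OF K.one_not_zero]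
      by simp_all
    then show ?thesis using x(1) h_eq_zero_iff by (intro image_eqI[of _ _ x]) auto
  qed
  then show "val ` (carrier Q - {\<zero>\<^bsub>Q\<^esub>}) = UNIV" by blast
qed

lemma closed_ball_iff_hahn_ball: "x \<in> carrier Q \<Longrightarrow> x \<in> closed_ball g \<longleftrightarrow> h x \<in> K.hahn_ball g"
  by (simp add: closed_ball_def hahn.closed_ball_def h_eq_zero_iff)

lemma valuation_ring_coeff_nonneg:
  assumes "x \<in> valuation_ring" "h x g \<noteq> \<zero>\<^bsub>K\<^esub>"
  shows "0 \<le> g"
proof -
  have "x \<in> carrier Q" using assms(1) by (rule closed_ball_carrier)
  then show ?thesis
    using assms K.hahn_ball_iff[of "h x" 0] by (auto simp: closed_ball_iff_hahn_ball)
qed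

lemma coeff_0_ring_hom: "(\<lambda>x. h x 0) \<in> ring_hom (Q\<lparr>carrier := valuation_ring\<rparr>) K"
proof (rule ring_hom_memI)
  fix x y
  assume "x \<in> carrier (Q\<lparr>carrier := valuation_ring\<rparr>)" "y \<in> carrier (Q\<lparr>carrier := valuation_ring\<rparr>)"
  then have x: "x \<in> valuation_ring" "x \<in> carrier Q" and y: "y \<in> valuation_ring" "y \<in> carrier Q"
    using closed_ball_carrier by auto
  have "(h x \<otimes>\<^bsub>hahn_ring K\<^esub> h y) (0 + 0) = h x 0 \<otimes>\<^bsub>K\<^esub> h y 0"
    using x y valuation_ring_coeff_nonneg by (intro K.hahn_mult_lowest_coeff) auto
  then show "h (x \<otimes>\<^bsub>Q\<lparr>carrier := valuation_ring\<rparr>\<^esub> y) 0 = h x 0 \<otimes>\<^bsub>K\<^esub> h y 0"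
    using x(2) y(2) by simp
  show "h (x \<oplus>\<^bsub>Q\<lparr>carrier := valuation_ring\<rparr>\<^esub> y) 0 = h x 0 \<oplus>\<^bsub>K\<^esub> h y 0"
    using x(2) y(2) by (simp add: K.hahn_add)
next
  show "h \<one>\<^bsub>Q\<lparr>carrier := valuation_ring\<rparr>\<^esub> 0 = \<one>\<^bsub>K\<^esub>"
    by (simp add: K.hahn_one)
qed (auto simp: K.hahn_coeff_closed dest!: closed_ball_carrier)

lemma coeff_0_eq_zero_iff:
  assumes x: "x \<in> valuation_ring"
  shows "h x 0 = \<zero>\<^bsub>K\<^esub> \<longleftrightarrow> x = \<zero>\<^bsub>Q\<^esub> \<or> 0 < val x"
proof (cases "x = \<zero>\<^bsub>Q\<^esub>")
  case False
  have x_carrier: "x \<in> carrier Q" using x by (rule closed_ball_carrier)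
  then have hahn: "h x \<in> carrier (hahn_ring K)" "h x \<noteq> \<zero>\<^bsub>hahn_ring K\<^esub>"
    using False h_eq_zero_iff by auto
  have "0 \<le> val x" using x False x_carrier by (simp add: closed_ball_nonzero)
  then show ?thesis
    using K.hahn_val_coeff[OF hahn] K.hahn_val_le[OF hahn, of 0] False
    by (cases "val x = 0") (auto simp: not_less)
qed (simp add: K.hahn_zero)

lemma residue_field_iso: "residue_field Q valuation_ring \<simeq> K"
proof (rule residue_field_isoI[OF K.ring_axioms coeff_0_ring_hom _ coeff_0_eq_zero_iff])
  show "(\<lambda>x. h x 0) ` valuation_ring = carrier K"
  proof (intro equalityI subsetI)
    fix c assume c: "c \<in> carrier K"
    then obtain x where x: "x \<in> carrier Q" "h x = K.monom_series c 0"
      using monom_series_in_image by (metis imageE)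
    have "K.monom_series c 0 \<in> K.hahn_ball 0"
      unfolding K.hahn_ball_iff[OF K.monom_series_closed[OF c]]
      by (auto simp: K.monom_series_def split: if_splits)
    then have "x \<in> valuation_ring" using x by (simp add: closed_ball_iff_hahn_ball)
    moreover have "c = h x 0" by (simp add: x(2) K.monom_series_def)
    ultimately show "c \<in> (\<lambda>x. h x 0) ` valuation_ring" by blast
  qed (auto simp: K.hahn_coeff_closed dest!: closed_ball_carrier)
qed

lemma essentially_uncountable_type_if_separated:
  assumes P: "uncountable P" "P \<subseteq> h ` carrier Q" "P \<subseteq> K.hahn_ball 0"
    and separated: "\<And>s t. s \<in> P \<Longrightarrow> t \<in> P \<Longrightarrow> s \<ominus>\<^bsub>hahn_ring K\<^esub> t \<in> K.hahn_ball g \<Longrightarrow> s = t"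
  shows "essentially_uncountable_type Q valuation_ring (carrier Q)"
proof (rule essentially_uncountable_typeI)
  let ?S = "{x \<in> carrier Q. h x \<in> P}"
  have "h ` ?S = P" using P(2) by auto
  then show "uncountable ?S" using P(1) by (metis countable_image)
  show "?S \<subseteq> valuation_ring" using P(3) by (auto simp: closed_ball_iff_hahn_ball)
  fix x y assume xy: "x \<in> ?S" "y \<in> ?S" and "x \<ominus>\<^bsub>Q\<^esub> y \<in> closed_ball g"
  then have "h x \<ominus>\<^bsub>hahn_ring K\<^esub> h y \<in> K.hahn_ball g"
    by (auto simp: closed_ball_iff_hahn_ball a_minus_def)
  then show "x = y" using separated[of "h x" "h y"] xy h_inj by (auto simp: inj_on_def)
qed

lemma strongly_countable_type_if_countable_dense:
  assumes "\<And>g. \<exists>T\<subseteq>carrier (hahn_ring K). countable T \<and>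
    (\<forall>f\<in>h ` carrier Q \<inter> K.hahn_ball 0. \<exists>t\<in>T. f \<ominus>\<^bsub>hahn_ring K\<^esub> t \<in> K.hahn_ball g)"
  shows "strongly_countable_type Q valuation_ring (carrier Q)"
proof (rule strongly_countable_typeI)
  fix g
  obtain T where T: "T \<subseteq> carrier (hahn_ring K)" "countable T"
    and dense: "\<forall>f\<in>h ` carrier Q \<inter> K.hahn_ball 0. \<exists>t\<in>T. f \<ominus>\<^bsub>hahn_ring K\<^esub> t \<in> K.hahn_ball g"
    using assms by metis
  then have "\<exists>t\<in>T. h x \<ominus>\<^bsub>hahn_ring K\<^esub> t \<in> K.hahn_ball g" if "x \<in> valuation_ring" for x
    using closed_ball_carrier[OF that] that by (auto simp: closed_ball_iff_hahn_ball)
  then obtain approx where approx: "\<And>x. x \<in> valuation_ring \<Longrightarrow> approx x \<in> T"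
      "\<And>x. x \<in> valuation_ring \<Longrightarrow> h x \<ominus>\<^bsub>hahn_ring K\<^esub> approx x \<in> K.hahn_ball g"
    by metis
  have "x \<ominus>\<^bsub>Q\<^esub> y \<in> closed_ball g"
    if x: "x \<in> valuation_ring" and y: "y \<in> valuation_ring" and eq: "approx x = approx y" for x y
  proof -
    note carrier = closed_ball_carrier[OF x] closed_ball_carrier[OF y]
    have "h (x \<ominus>\<^bsub>Q\<^esub> y) = (h x \<ominus>\<^bsub>hahn_ring K\<^esub> approx x) \<ominus>\<^bsub>hahn_ring K\<^esub> (h y \<ominus>\<^bsub>hahn_ring K\<^esub> approx x)"
    proof -
      have "h (x \<ominus>\<^bsub>Q\<^esub> y) = h x \<ominus>\<^bsub>hahn_ring K\<^esub> h y" using carrier by (simp add: a_minus_def)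
      moreover have "approx x \<in> carrier (hahn_ring K)" using approx(1)[OF x] T(1) by blast
      ultimately show ?thesis
        using h.hom_closed[OF carrier(1)] h.hom_closed[OF carrier(2)] by algebra
    qed
    also have "\<dots> \<in> K.hahn_ball g"
      using approx(2)[OF x] approx(2)[OF y] unfolding eq by (rule hahn.closed_ball_minus)
    finally show ?thesis using carrier by (simp add: closed_ball_iff_hahn_ball)
  qed
  moreover have "countable (approx ` valuation_ring)"
    using T(2) approx(1) by (meson countable_subset image_subsetI)
  ultimately show "\<exists>approx :: 'q \<Rightarrow> 'g \<Rightarrow> 'k. countable (approx ` valuation_ring) \<and>
      (\<forall>x\<in>valuation_ring. \<forall>y\<in>valuation_ring. approx x = approx y \<longrightarrow> x \<ominus>\<^bsub>Q\<^esub> y \<in> closed_ball g)"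
    by blast
qed

end

lemma field_nat_set_copy:
  assumes "field F" "card_le_aleph1 (carrier F)"
  obtains Q :: "nat set ring" and h where "field Q" "h \<in> ring_iso Q F" "card_le_aleph1 (carrier Q)"
proof -
  interpret F: field F by fact
  obtain f where f: "inj_on f (carrier F)" "f ` carrier F \<subseteq> omega1_idx"
    using assms(2) card_of_omega1_idx unfolding card_le_aleph1_def
    by (meson card_of_ordLeq ordIso_symmetric ordLeq_ordIso_trans)
  have iso: "f \<in> ring_iso F (image_ring f F)" by (rule inj_imp_image_ring_iso[OF f(1)])
  show thesis
  proof (rule that)
    show "field (image_ring f F)" by (rule F.inj_imp_image_ring_is_field[OF f(1)])
    show "inv_into (carrier F) f \<in> ring_iso (image_ring f F) F"
      by (rule ring_iso_set_sym[OF F.ring_axioms iso])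
    show "card_le_aleph1 (carrier (image_ring f F))"
      unfolding image_ring_carrier card_le_aleph1_def
      using card_of_image assms(2)[unfolded card_le_aleph1_def] by (rule ordLeq_transitive)
  qed
qed

lemma (in field) exists_hahn_embedding_onto:
  fixes scale :: "nat set \<Rightarrow> 'g::linordered_ab_group_add"
  assumes scale: "omega1_scale scale"
    and E: "subfield E (hahn :: ('g \<Rightarrow> 'a) ring)" "card_le_aleph1 E"
    and monom: "\<And>c g. c \<in> carrier R \<Longrightarrow> monom_series c g \<in> E"
  obtains Q :: "nat set ring" and h where "hahn_embedding R Q scale h" "h ` carrier Q = E"
proof -
  interpret H: field "hahn :: ('g \<Rightarrow> 'a) ring" by (rule field_hahn)
  have "field (hahn\<lparr>carrier := E\<rparr>)" by (rule H.subfield_iff(2)[OF E(1)])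
  then obtain Q :: "nat set ring" and h
    where Q: "field Q" and iso: "h \<in> ring_iso Q (hahn\<lparr>carrier := E\<rparr>)"
      and card: "card_le_aleph1 (carrier Q)"
    by (rule field_nat_set_copy) (simp add: E(2))
  have image: "h ` carrier Q = E" using iso by (simp add: ring_iso_def bij_betw_def)
  have "h \<in> ring_hom Q hahn"
    using iso subfieldE(3)[OF E(1)] by (auto simp: ring_iso_def ring_hom_def)
  then have "hahn_embedding R Q scale h"
    using Q card scale monom image field_axioms
    by (intro hahn_embedding.intro hahn_embedding_axioms.intro) auto
  then show thesis using image that by blast
qed

section \<open>Rational Hahn series\<close>

definition quotients :: "('a, 'b) ring_scheme \<Rightarrow> 'a set \<Rightarrow> 'a set" where
  "quotients R B = {x \<in> carrier R. \<exists>b\<in>B. b \<noteq> \<zero>\<^bsub>R\<^esub> \<and> x \<otimes>\<^bsub>R\<^esub> b \<in> B}"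

context field
begin

lemma quotientsI: "x \<in> carrier R \<Longrightarrow> b \<in> B \<Longrightarrow> b \<noteq> \<zero> \<Longrightarrow> x \<otimes> b \<in> B \<Longrightarrow> x \<in> quotients R B"
  by (auto simp: quotients_def)

lemma quotients_subset_image:
  assumes "B \<subseteq> carrier R"
  shows "quotients R B \<subseteq> (\<lambda>(a, b). a \<otimes> inv b) ` (B \<times> B)"
proof
  fix x assume "x \<in> quotients R B"
  then obtain b where b: "x \<in> carrier R" "b \<in> B" "b \<noteq> \<zero>" "x \<otimes> b \<in> B" by (auto simp: quotients_def)
  then have "b \<in> Units R" using assms by (auto simp: field_Units)
  then have "x \<otimes> b \<otimes> inv b = x" using b(1) by (simp add: m_assoc Units_closed)
  then have "x = (\<lambda>(a, b). a \<otimes> inv b) (x \<otimes> b, b)" by simp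
  then show "x \<in> (\<lambda>(a, b). a \<otimes> inv b) ` (B \<times> B)" using b(2,4) by blast
qed

lemma subset_quotients:
  assumes "subring B R"
  shows "B \<subseteq> quotients R B"
  using subringE(1,3)[OF assms] by (auto intro!: quotientsI[of _ \<one>])

lemma subring_quotients:
  assumes B: "subring B R"
  shows "subring (quotients R B) R"
proof (rule subringI)
  show "quotients R B \<subseteq> carrier R" by (auto simp: quotients_def)
  show "\<one> \<in> quotients R B" using subset_quotients[OF B] subringE(3)[OF B] by blast
next
  fix x assume "x \<in> quotients R B"
  then obtain b where b: "x \<in> carrier R" "b \<in> B" "b \<noteq> \<zero>" "x \<otimes> b \<in> B" by (auto simp: quotients_def)
  moreover have "\<ominus> x \<otimes> b = \<ominus> (x \<otimes> b)" using b(1,2) subringE(1)[OF B] by (auto simp: l_minus)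
  ultimately show "\<ominus> x \<in> quotients R B"
    using subringE(5)[OF B] by (intro quotientsI[of _ b]) auto
next
  fix x y assume "x \<in> quotients R B" "y \<in> quotients R B"
  then obtain b d where x: "x \<in> carrier R" "b \<in> B" "b \<noteq> \<zero>" "x \<otimes> b \<in> B"
    and y: "y \<in> carrier R" "d \<in> B" "d \<noteq> \<zero>" "y \<otimes> d \<in> B" by (auto simp: quotients_def)
  have carrier: "b \<in> carrier R" "d \<in> carrier R" using x(2) y(2) subringE(1)[OF B] by auto
  then have bd: "b \<otimes> d \<in> B" "b \<otimes> d \<noteq> \<zero>"
    using x y subringE(6)[OF B] by (auto simp: integral_iff)
  have "x \<otimes> y \<otimes> (b \<otimes> d) = (x \<otimes> b) \<otimes> (y \<otimes> d)" using x(1) y(1) carrier by algebra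
  also have "\<dots> \<in> B" using x(4) y(4) by (rule subringE(6)[OF B])
  finally show "x \<otimes> y \<in> quotients R B" using x(1) y(1) bd by (intro quotientsI) auto
  have "(x \<oplus> y) \<otimes> (b \<otimes> d) = (x \<otimes> b) \<otimes> d \<oplus> (y \<otimes> d) \<otimes> b" using x(1) y(1) carrier by algebra
  also have "\<dots> \<in> B"
    by (rule subringE(7)[OF B subringE(6)[OF B x(4) y(2)] subringE(6)[OF B y(4) x(2)]])
  finally show "x \<oplus> y \<in> quotients R B" using x(1) y(1) bd by (intro quotientsI) auto
qed

lemma subfield_quotients:
  assumes B: "subring B R"
  shows "subfield (quotients R B) R"
proof (rule subfieldI'[OF subring_quotients[OF B]])
  fix x assume "x \<in> quotients R B - {\<zero>}"
  then obtain b where x: "x \<in> carrier R" "x \<noteq> \<zero>" and b: "b \<in> B" "b \<noteq> \<zero>" "x \<otimes> b \<in> B"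
    by (auto simp: quotients_def)
  have inv: "inv x \<in> carrier R" "inv x \<otimes> x = \<one>" using x by (auto simp: field_Units)
  have b_carrier: "b \<in> carrier R" using b(1) subringE(1)[OF B] by blast
  have "inv x \<otimes> (x \<otimes> b) = b" using inv x(1) b_carrier by (simp flip: m_assoc)
  then show "inv x \<in> quotients R B"
    using inv(1) b x b_carrier by (intro quotientsI[of _ "x \<otimes> b"]) (auto simp: integral_iff)
qed

definition finite_series :: "'g::linordered_ab_group_add set \<Rightarrow> ('g \<Rightarrow> 'a) set" where
  "finite_series D = {f. range f \<subseteq> carrier R \<and> finite (supp f) \<and> supp f \<subseteq> D}"

lemma finite_series_subset: "finite_series D \<subseteq> carrier hahn"
  by (auto simp: finite_series_def hahn_carrier_iff wfp_on_less_finite)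

lemma finite_series_ordLeq_Fpow: "|finite_series D| \<le>o |Fpow (D \<times> carrier R)|"
proof -
  have "finite_series D \<subseteq> {f. f ` D \<subseteq> carrier R \<and> supp f \<subseteq> D \<and> finite (supp f)}"
    by (auto simp: finite_series_def)
  then show ?thesis
    by (rule ordLeq_transitive[OF card_of_mono1 restricted_funspace_ordLeq_Fpow])
qed

lemma monom_series_finite: "c \<in> carrier R \<Longrightarrow> monom_series c g \<in> finite_series UNIV"
  by (auto simp: finite_series_def monom_series_def)

lemma subring_finite_series:
  "subring (finite_series UNIV) (hahn :: ('g::linordered_ab_group_add \<Rightarrow> 'a) ring)"
proof -
  interpret H: field "hahn :: ('g \<Rightarrow> 'a) ring" by (rule field_hahn)
  have finiteI: "f \<in> finite_series UNIV" if "f \<in> carrier hahn" "supp f \<subseteq> D" "finite D" for f D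
    using that hahn_coeff_closed[OF that(1)] by (auto simp: finite_series_def intro: finite_subset)
  have finite_supp: "finite (supp f)" if "f \<in> finite_series UNIV" for f :: "'g \<Rightarrow> 'a"
    using that by (simp add: finite_series_def)
  show ?thesis
  proof (rule H.subringI)
    show "finite_series UNIV \<subseteq> carrier hahn" by (rule finite_series_subset)
    show "\<one>\<^bsub>hahn\<^esub> \<in> finite_series UNIV"
      unfolding hahn_one_eq_monom_series by (rule monom_series_finite[OF one_closed])
  next
    fix f :: "'g \<Rightarrow> 'a" assume f: "f \<in> finite_series UNIV"
    then have carrier: "f \<in> carrier hahn" using finite_series_subset by blast
    have "supp (\<ominus>\<^bsub>hahn\<^esub> f) \<subseteq> supp f"
      by (auto simp: hahn_uminus_coeff[OF carrier])
    then show "\<ominus>\<^bsub>hahn\<^esub> f \<in> finite_series UNIV"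
      using carrier finite_supp[OF f] by (intro finiteI) auto
  next
    fix f h :: "'g \<Rightarrow> 'a" assume f: "f \<in> finite_series UNIV" and h: "h \<in> finite_series UNIV"
    then have carrier: "f \<in> carrier hahn" "h \<in> carrier hahn" using finite_series_subset by auto
    have "supp (f \<oplus>\<^bsub>hahn\<^esub> h) \<subseteq> supp f \<union> supp h" by (auto simp: hahn_add)
    then show "f \<oplus>\<^bsub>hahn\<^esub> h \<in> finite_series UNIV"
      by (rule finiteI[OF H.a_closed[OF carrier]]) (simp only: finite_supp f h finite_Un)
    show "f \<otimes>\<^bsub>hahn\<^esub> h \<in> finite_series UNIV"
      by (rule finiteI[OF H.m_closed[OF carrier] supp_hahn_mult])
        (simp only: finite_supp f h finite_SigmaI finite_imageI)
  qed
qed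

definition truncate :: "('g::linordered_ab_group_add \<Rightarrow> 'a) \<Rightarrow> 'g \<Rightarrow> ('g \<Rightarrow> 'a)" where
  "truncate f g = (\<lambda>x. if x \<in> {0..<g} then f x else \<zero>)"

lemma truncate_finite_series:
  assumes "f \<in> finite_series UNIV"
  shows "truncate f g \<in> finite_series {0..<g}"
proof -
  have "supp (truncate f g) \<subseteq> supp f" by (auto simp: truncate_def)
  then have "finite (supp (truncate f g))"
    by (rule finite_subset) (use assms in \<open>simp add: finite_series_def\<close>)
  then show ?thesis using assms by (auto simp: finite_series_def truncate_def)
qed

lemma truncate_close:
  fixes f :: "'g::linordered_ab_group_add \<Rightarrow> 'a"
  assumes "f \<in> finite_series UNIV" "f \<in> hahn_ball 0"
  shows "f \<ominus>\<^bsub>hahn\<^esub> truncate f g \<in> hahn_ball g"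
proof -
  interpret H: field "hahn :: ('g \<Rightarrow> 'a) ring" by (rule field_hahn)
  have carrier: "f \<in> carrier hahn" "truncate f g \<in> carrier hahn"
    using assms(1) truncate_finite_series finite_series_subset by blast+
  have "supp f \<subseteq> {0..}" using assms(2) hahn_ball_iff[OF carrier(1)] by simp
  moreover have "(f \<ominus>\<^bsub>hahn\<^esub> truncate f g) x = (if x \<in> {0..<g} then \<zero> else f x)" for x
    using hahn_coeff_closed[OF carrier(1)]
    by (simp add: hahn_minus_coeff[OF carrier(2)]) (simp add: truncate_def a_minus_def r_neg)
  ultimately have "supp (f \<ominus>\<^bsub>hahn\<^esub> truncate f g) \<subseteq> {g..}" by (auto simp: not_less)
  then show ?thesis using hahn_ball_iff[OF H.minus_closed[OF carrier]] by blast
qed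

lemma truncate_unit:
  assumes b: "b \<in> carrier hahn" "b \<noteq> \<zero>\<^bsub>hahn\<^esub>" "hahn_val b = 0" and g: "0 < g"
  shows "truncate b g \<noteq> \<zero>\<^bsub>hahn\<^esub>" "hahn_val (truncate b g) = 0"
proof -
  have leading: "truncate b g 0 \<noteq> \<zero>"
    using g hahn_val_coeff[OF b(1,2)] by (simp add: truncate_def b(3))
  then show "truncate b g \<noteq> \<zero>\<^bsub>hahn\<^esub>" by (auto simp: hahn_zero)
  show "hahn_val (truncate b g) = 0"
    unfolding hahn_val_def using leading
    by (rule Least_equality) (auto simp: truncate_def split: if_splits)
qed

lemma quotients_finite_series_cases:
  fixes x :: "'g::linordered_ab_group_add \<Rightarrow> 'a"
  assumes "x \<in> quotients hahn (finite_series UNIV)"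
  obtains b where "b \<in> finite_series UNIV" "b \<noteq> \<zero>\<^bsub>hahn\<^esub>" "hahn_val b = 0"
    "x \<otimes>\<^bsub>hahn\<^esub> b \<in> finite_series UNIV"
proof -
  interpret H: field "hahn :: ('g \<Rightarrow> 'a) ring" by (rule field_hahn)
  obtain d where d: "x \<in> carrier hahn" "d \<in> finite_series UNIV" "d \<noteq> \<zero>\<^bsub>hahn\<^esub>"
      "x \<otimes>\<^bsub>hahn\<^esub> d \<in> finite_series UNIV"
    using assms by (auto simp: quotients_def)
  have d_carrier: "d \<in> carrier hahn" using d(2) finite_series_subset by blast
  define m where "m = monom_series \<one> (- hahn_val d)"
  have m: "m \<in> finite_series UNIV" "m \<in> carrier hahn" "m \<noteq> \<zero>\<^bsub>hahn\<^esub>" "hahn_val m = - hahn_val d"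
    unfolding m_def
    by (simp_all add: monom_series_finite monom_series_closed monom_series_nonzero
        hahn_val_monom_series)
  show thesis
  proof (rule that)
    show "m \<otimes>\<^bsub>hahn\<^esub> d \<in> finite_series UNIV"
      using m(1) d(2) by (rule subringE(6)[OF subring_finite_series])
    show "m \<otimes>\<^bsub>hahn\<^esub> d \<noteq> \<zero>\<^bsub>hahn\<^esub>" using m d d_carrier by (simp add: H.integral_iff)
    show "hahn_val (m \<otimes>\<^bsub>hahn\<^esub> d) = 0" using m d d_carrier by (simp add: hahn_val_mult)
    have "x \<otimes>\<^bsub>hahn\<^esub> (m \<otimes>\<^bsub>hahn\<^esub> d) = m \<otimes>\<^bsub>hahn\<^esub> (x \<otimes>\<^bsub>hahn\<^esub> d)"
      using d(1) m(2) d_carrier by (rule hahn_mult_left_comm)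
    also have "\<dots> \<in> finite_series UNIV"
      using m(1) d(4) by (rule subringE(6)[OF subring_finite_series])
    finally show "x \<otimes>\<^bsub>hahn\<^esub> (m \<otimes>\<^bsub>hahn\<^esub> d) \<in> finite_series UNIV" .
  qed
qed

lemma quotients_finite_series_approx:
  fixes x :: "'g::linordered_ab_group_add \<Rightarrow> 'a"
  assumes g: "0 < g" and x: "x \<in> quotients hahn (finite_series UNIV)" "x \<in> hahn_ball 0"
  shows "\<exists>y\<in>quotients hahn (finite_series {0..<g}). x \<ominus>\<^bsub>hahn\<^esub> y \<in> hahn_ball g"
proof -
  interpret H: valued_field "hahn :: ('g \<Rightarrow> 'a) ring" hahn_val by (rule valued_field_hahn)
  have x_carrier: "x \<in> carrier hahn" using x(2) by (rule H.closed_ball_carrier)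
  obtain b where b: "b \<in> finite_series UNIV" "b \<noteq> \<zero>\<^bsub>hahn\<^esub>" "hahn_val b = 0"
    and xb: "x \<otimes>\<^bsub>hahn\<^esub> b \<in> finite_series UNIV"
    using x(1) by (rule quotients_finite_series_cases)
  have b_carrier: "b \<in> carrier hahn" using b(1) finite_series_subset by blast
  have xb_ball: "x \<otimes>\<^bsub>hahn\<^esub> b \<in> hahn_ball 0"
    using H.closed_ball_mult_iff[OF x_carrier b_carrier b(2), of 0] x(2) b(3) by simp
  have b_ball: "b \<in> hahn_ball 0" using b b_carrier by (simp add: H.closed_ball_nonzero)
  define a where "a = truncate (x \<otimes>\<^bsub>hahn\<^esub> b) g"
  define c where "c = truncate b g"
  have ac: "a \<in> finite_series {0..<g}" "c \<in> finite_series {0..<g}"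
    unfolding a_def c_def using xb b(1) by (simp_all add: truncate_finite_series)
  then have ac_carrier: "a \<in> carrier hahn" "c \<in> carrier hahn" using finite_series_subset by blast+
  have c: "c \<noteq> \<zero>\<^bsub>hahn\<^esub>" "hahn_val c = 0"
    unfolding c_def using truncate_unit[OF b_carrier b(2,3) g] by simp_all
  obtain y where y: "y \<in> carrier hahn" "y \<otimes>\<^bsub>hahn\<^esub> c = a"
    using hahn_quotient_exists[OF ac_carrier c(1)] ac_carrier(2) H.m_comm by metis
  have "a \<in> hahn_ball 0"
    using ac(1) by (auto simp: hahn_ball_iff[OF ac_carrier(1)] finite_series_def)
  then have "y \<in> hahn_ball 0"
    using H.closed_ball_mult_iff[OF y(1) ac_carrier(2) c(1), of 0] y(2) c(2) by simp
  then have "x \<ominus>\<^bsub>hahn\<^esub> y \<in> hahn_ball g"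
  proof (rule H.closed_ball_quotient_minus[OF x_carrier _ b_carrier b(2,3) ac_carrier(2)])
    show "x \<otimes>\<^bsub>hahn\<^esub> b \<ominus>\<^bsub>hahn\<^esub> y \<otimes>\<^bsub>hahn\<^esub> c \<in> hahn_ball g"
      unfolding y(2) a_def by (rule truncate_close[OF xb xb_ball])
    show "b \<ominus>\<^bsub>hahn\<^esub> c \<in> hahn_ball g"
      unfolding c_def by (rule truncate_close[OF b(1) b_ball])
  qed
  moreover have "y \<in> quotients hahn (finite_series {0..<g})"
    using y ac c(1) by (auto simp: quotients_def)
  ultimately show ?thesis by blast
qed

definition subset_series :: "(nat \<Rightarrow> 'g) \<Rightarrow> nat set \<Rightarrow> 'g::linordered_ab_group_add \<Rightarrow> 'a" where
  "subset_series s N = (\<lambda>g. if g \<in> s ` N then \<one> else \<zero>)"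

lemma supp_subset_series: "supp (subset_series s N) = s ` N"
  by (auto simp: subset_series_def)

lemma subset_series_closed:
  assumes "strict_mono s"
  shows "subset_series s N \<in> carrier hahn"
proof -
  have "wfp_on (range s) (<)"
    using assms by (simp add: wfp_on_image strict_mono_less)
  then have "wfp_on (supp (subset_series s N)) (<)"
    unfolding supp_subset_series by (rule wfp_on_subset) auto
  then show ?thesis by (auto simp: hahn_carrier_iff subset_series_def)
qed

lemma inj_subset_series:
  assumes "strict_mono s"
  shows "inj (subset_series s)"
  by (rule injI) (metis assms inj_image_eq_iff strict_mono_imp_inj_on supp_subset_series)

lemma subset_series_separated:
  fixes s :: "nat \<Rightarrow> 'g::linordered_ab_group_add"
  assumes s: "strict_mono s" "\<And>n. s n < g"
    and close: "subset_series s M \<ominus>\<^bsub>hahn\<^esub> subset_series s N \<in> hahn_ball g"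
  shows "subset_series s M = subset_series s N"
proof
  fix x
  interpret H: field "hahn :: ('g \<Rightarrow> 'a) ring" by (rule field_hahn)
  note closed = subset_series_closed[OF s(1), of M] subset_series_closed[OF s(1), of N]
  show "subset_series s M x = subset_series s N x"
  proof (cases "x < g")
    case True
    then have "(subset_series s M \<ominus>\<^bsub>hahn\<^esub> subset_series s N) x = \<zero>"
      using close unfolding hahn_ball_iff[OF H.minus_closed[OF closed]] by force
    then show ?thesis
      unfolding hahn_minus_coeff[OF closed(2)]
      using hahn_coeff_closed closed by (metis r_right_minus_eq)
  next
    case False
    then have "x \<notin> range s" using s(2) by blast
    then show ?thesis by (auto simp: subset_series_def)
  qed
qed

end

lemma (in omega1_scale) exists_bounded_strict_mono:
  obtains s :: "nat \<Rightarrow> 'g" and g where "strict_mono s" "\<And>n. 0 \<le> s n" "\<And>n. s n < g"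
proof -
  have "\<exists>y. 0 \<le> y \<and> x < y" for x :: 'g
    using scale_cofinal[of x] scale_pos less_imp_le by blast
  then have "\<exists>s :: nat \<Rightarrow> 'g. \<forall>n. 0 \<le> s n \<and> s n < s (Suc n)"
    by (intro dependent_nat_choice) auto
  then obtain s :: "nat \<Rightarrow> 'g" where s: "\<And>n. 0 \<le> s n" "\<And>n. s n < s (Suc n)" by blast
  obtain \<sigma> where "\<And>n. s n < scale \<sigma>"
    using countable_bounded[of "range s"] by auto
  moreover have "strict_mono s" using s(2) by (simp add: strict_mono_Suc_iff)
  ultimately show thesis using s(1) that by blast
qed

locale omega1_hahn_field = K: field K + omega1_scale scale
  for K :: "('k, 'e) ring_scheme" and scale :: "nat set \<Rightarrow> 'g::linordered_ab_group_add" +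
  assumes countable_coefficients: "countable (carrier K)"
    and card_le_aleph1_exponents: "card_le_aleph1 (UNIV :: 'g set)"
    and countable_interval: "countable {0..<g :: 'g}"
begin

interpretation hahn: valued_field "hahn_ring K :: ('g \<Rightarrow> 'k) ring" K.hahn_val
  by (rule K.valued_field_hahn)

lemma card_le_aleph1_finite_series: "|K.finite_series (D :: 'g set)| \<le>o aleph1"
proof -
  have "|D| \<le>o aleph1" "|carrier K| \<le>o aleph1"
    using card_le_aleph1_subset[OF card_le_aleph1_exponents, of D]
      countable_Cinfinite_bound[OF countable_coefficients Cinfinite_aleph1]
    by (simp_all add: card_le_aleph1_def)
  then have "|Fpow (D \<times> carrier K)| \<le>o aleph1"
    by (intro Fpow_Cinfinite_bound Times_Cinfinite_bound Cinfinite_aleph1)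
  then show ?thesis by (rule ordLeq_transitive[OF K.finite_series_ordLeq_Fpow])
qed

lemma countable_quotients_finite_series:
  "countable (quotients (hahn_ring K) (K.finite_series {0..<g :: 'g}))"
proof -
  have "countable (Fpow ({0..<g} \<times> carrier K))"
    by (intro countable_Fpow countable_SIGMA countable_interval countable_coefficients)
  then have "countable (K.finite_series {0..<g})"
    by (rule countable_ordLeq[OF K.finite_series_ordLeq_Fpow])
  then show ?thesis
    by (intro countable_subset[OF hahn.quotients_subset_image[OF K.finite_series_subset]]) auto
qed

lemma card_le_aleph1_quotients_finite_series:
  "card_le_aleph1 (quotients (hahn_ring K) (K.finite_series (UNIV :: 'g set)))"
proof -
  let ?F = "K.finite_series (UNIV :: 'g set)"
  have "|?F \<times> ?F| \<le>o aleph1"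
    by (intro Times_Cinfinite_bound card_le_aleph1_finite_series Cinfinite_aleph1)
  then have "card_le_aleph1 ((\<lambda>(a, b). a \<otimes>\<^bsub>hahn_ring K\<^esub> inv\<^bsub>hahn_ring K\<^esub> b) ` (?F \<times> ?F))"
    unfolding card_le_aleph1_def by (rule ordLeq_transitive[OF card_of_image])
  then show ?thesis
    by (rule card_le_aleph1_subset) (rule hahn.quotients_subset_image[OF K.finite_series_subset])
qed

lemma exists_strongly_countable_embedding:
  obtains Q :: "nat set ring" and h where "hahn_embedding K Q scale h"
    "strongly_countable_type Q (valued_field.closed_ball Q (K.hahn_val \<circ> h) 0) (carrier Q)"
proof -
  let ?E = "quotients (hahn_ring K) (K.finite_series (UNIV :: 'g set))"
  have "K.monom_series c g \<in> ?E" if "c \<in> carrier K" for c g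
    using hahn.subset_quotients[OF K.subring_finite_series] K.monom_series_finite[OF that] by blast
  then obtain Q :: "nat set ring" and h
    where Q: "hahn_embedding K Q scale h" "h ` carrier Q = ?E"
    using K.exists_hahn_embedding_onto[OF omega1_scale_axioms
        hahn.subfield_quotients[OF K.subring_finite_series] card_le_aleph1_quotients_finite_series]
    by blast
  interpret Q: hahn_embedding K Q scale h by (rule Q(1))
  have "strongly_countable_type Q Q.valuation_ring (carrier Q)"
  proof (rule Q.strongly_countable_type_if_countable_dense)
    fix g
    obtain \<sigma> where "g < scale \<sigma>" using scale_cofinal by blast
    then have ball: "K.hahn_ball (scale \<sigma>) \<subseteq> K.hahn_ball g" by (simp add: hahn.closed_ball_antimono)
    let ?T = "quotients (hahn_ring K) (K.finite_series {0..<scale \<sigma>})"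
    have "\<forall>f\<in>h ` carrier Q \<inter> K.hahn_ball 0. \<exists>t\<in>?T. f \<ominus>\<^bsub>hahn_ring K\<^esub> t \<in> K.hahn_ball g"
      using K.quotients_finite_series_approx[OF scale_pos] ball unfolding Q(2) by blast
    moreover have "?T \<subseteq> carrier (hahn_ring K)" by (auto simp: quotients_def)
    ultimately show "\<exists>T\<subseteq>carrier (hahn_ring K). countable T \<and>
        (\<forall>f\<in>h ` carrier Q \<inter> K.hahn_ball 0. \<exists>t\<in>T. f \<ominus>\<^bsub>hahn_ring K\<^esub> t \<in> K.hahn_ball g)"
      using countable_quotients_finite_series by blast
  qed
  then show thesis using Q(1) that by blast
qed

lemma exists_essentially_uncountable_embedding:
  obtains Q :: "nat set ring" and h where "hahn_embedding K Q scale h"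
    "essentially_uncountable_type Q (valued_field.closed_ball Q (K.hahn_val \<circ> h) 0) (carrier Q)"
proof -
  obtain s :: "nat \<Rightarrow> 'g" and g where s: "strict_mono s" "\<And>n. 0 \<le> s n" "\<And>n. s n < g"
    by (rule exists_bounded_strict_mono) blast
  let ?P = "K.subset_series s ` omega1_idx"
  let ?H = "K.finite_series UNIV \<union> ?P"
  let ?E = "generate_field (hahn_ring K) ?H"
  have "|?P| \<le>o aleph1"
    using card_of_image card_of_omega1_idx by (rule ordLeq_ordIso_trans)
  then have "card_le_aleph1 ?E"
    unfolding card_le_aleph1_def
    by (intro hahn.generate_field_Cinfinite_bound Un_Cinfinite_bound card_le_aleph1_finite_series
        Cinfinite_aleph1)
  moreover have "?H \<subseteq> carrier (hahn_ring K)"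
    using K.finite_series_subset K.subset_series_closed[OF s(1)] by auto
  then have "subfield ?E (hahn_ring K)" by (rule hahn.generate_field_is_subfield)
  moreover have "K.monom_series c g \<in> ?E" if "c \<in> carrier K" for c g
    using K.monom_series_finite[OF that] by (auto intro: generate_field.incl)
  ultimately obtain Q :: "nat set ring" and h
    where Q: "hahn_embedding K Q scale h" "h ` carrier Q = ?E"
    using K.exists_hahn_embedding_onto[OF omega1_scale_axioms] by blast
  interpret Q: hahn_embedding K Q scale h by (rule Q(1))
  have "essentially_uncountable_type Q Q.valuation_ring (carrier Q)"
  proof (rule Q.essentially_uncountable_type_if_separated)
    show "uncountable ?P"
      using uncountable_omega1_idx K.inj_subset_series[OF s(1)]
      by (meson countable_image_inj_on inj_on_subset subset_UNIV)
    show "?P \<subseteq> h ` carrier Q" unfolding Q(2) by (auto intro: generate_field.incl)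
    show "?P \<subseteq> K.hahn_ball 0"
      using s(2)
      by (auto simp: K.hahn_ball_iff[OF K.subset_series_closed[OF s(1)]] K.supp_subset_series)
    show "x = y" if "x \<in> ?P" "y \<in> ?P" "x \<ominus>\<^bsub>hahn_ring K\<^esub> y \<in> K.hahn_ball g" for x y
      using that K.subset_series_separated[OF s(1,3)] by blast
  qed
  then show thesis using Q(1) that by blast
qed

end

theorem mainTheorem2:
  fixes K :: "('k, 'e) ring_scheme"
  assumes "field K" and "countable (carrier K)"
  shows "\<exists>(Q1 :: nat set ring) R1 (Q2 :: nat set ring) R2.
    valuation_domain_in Q1 R1 \<and> valuation_domain_in Q2 R2 \<and>
    card_eq_aleph1 R1 \<and> card_eq_aleph1 R2 \<and>
    residue_field Q1 R1 \<simeq> K \<and> residue_field Q2 R2 \<simeq> K \<and>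
    same_value_group Q1 R1 Q2 R2 \<and>
    (\<exists>S \<subseteq> carrier Q1. card_le_aleph1 S \<and> rspan Q1 R1 S = carrier Q1) \<and>
    (\<forall>S \<subseteq> carrier Q1. countable S \<longrightarrow> rspan Q1 R1 S \<noteq> carrier Q1) \<and>
    (\<exists>S \<subseteq> carrier Q2. card_le_aleph1 S \<and> rspan Q2 R2 S = carrier Q2) \<and>
    (\<forall>S \<subseteq> carrier Q2. countable S \<longrightarrow> rspan Q2 R2 S \<noteq> carrier Q2) \<and>
    essentially_uncountable_type Q1 R1 (carrier Q1) \<and>
    strongly_countable_type Q2 R2 (carrier Q2)"
proof -
  interpret omega1_hahn_field K lex_scale
    by (intro omega1_hahn_field.intro omega1_hahn_field_axioms.intro assms
        omega1_scale_lex_scale card_le_aleph1_lex_group countable_lex_group_interval)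
  obtain Q1 :: "nat set ring" and h1 where emb1: "hahn_embedding K Q1 lex_scale h1"
    and type1: "essentially_uncountable_type Q1
      (valued_field.closed_ball Q1 (K.hahn_val \<circ> h1) 0) (carrier Q1)"
    by (rule exists_essentially_uncountable_embedding)
  obtain Q2 :: "nat set ring" and h2 where emb2: "hahn_embedding K Q2 lex_scale h2"
    and type2: "strongly_countable_type Q2
      (valued_field.closed_ball Q2 (K.hahn_val \<circ> h2) 0) (carrier Q2)"
    by (rule exists_strongly_countable_embedding)
  interpret Q1: hahn_embedding K Q1 lex_scale h1 by (rule emb1)
  interpret Q2: hahn_embedding K Q2 lex_scale h2 by (rule emb2)
  have same_group: "same_value_group Q1 Q1.valuation_ring Q2 Q2.valuation_ring"
    by (rule same_value_group_valuation_ring[OF Q1.valued_field_axioms Q1.v_surj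
          Q2.valued_field_axioms Q2.v_surj])
  show ?thesis
    by (rule exI[of _ Q1], rule exI[of _ Q1.valuation_ring],
        rule exI[of _ Q2], rule exI[of _ Q2.valuation_ring])
      (simp add: Q1.valuation_domain_in Q2.valuation_domain_in
        Q1.card_eq_aleph1_valuation_ring Q2.card_eq_aleph1_valuation_ring
        Q1.residue_field_iso Q2.residue_field_iso same_group
        Q1.generated_by_aleph1 Q2.generated_by_aleph1
        Q1.not_countably_generated Q2.not_countably_generated type1 type2)
qed

end
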